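(* Let $\Xi(x)$ be a nonzero even doubly-periodic (periods $2\omega_1,2\omega_3$) solution of $$\left\{\frac{d^3}{dx^3}-4(v(x)-E)\frac{d}{dx}-2\frac{dv(x)}{dx}\right\}\Xi(x)=0$$ of the form $$\Xi(x)=c_0+\sum_{i=0}^3\sum_{j=0}^{l_i-1}b^{(i)}_j\wp(x+\omega_i)^{l_i-j}+\sum_{i'=1}^M\sum_{j=0}^{r_{i'}-1}\frac{d^{(i')}_j}{(\wp(x)-\wp(\delta_{i'}))^{r_{i'}-j}},$$ and let $Q$ be the ($x$-independent) value $$Q=\Xi(x)^2(E-v(x))+\frac12\Xi(x)\frac{d^2\Xi(x)}{dx^2}-\frac14\left(\frac{d\Xi(x)}{dx}\right)^2.$$ Then the function $$\Lambda(x)=\sqrt{\Xi(x)}\exp\int\frac{\sqrt{-Q}\,dx}{\Xi(x)}$$ is a solution of the differential equation $-f''(x)+v(x)f(x)=Ef(x)$, and the function $$\Lambda_g(x)=\Psi_g(x)\sqrt{\Xi(x)}\exp\int\frac{\sqrt{-Q}\,dx}{\Xi(x)}$$ is a solution of the differential equation $(H_g-E-C_g)f_g(x)=0$.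
   Context: $\wp$ is the Weierstrass function with periods $(2\omega_1,2\omega_3)$ ($\omega_1,\omega_3$ linearly independent over $\mathbb{R}$), $\omega_0=0$, $\omega_2=-\omega_1-\omega_3$, $e_i=\wp(\omega_i)$ $(i=1,2,3)$, $g_2=-4(e_1e_2+e_2e_3+e_3e_1)$, $g_3=4e_1e_2e_3$. $M\ge0$ is an integer, $l_i\in\mathbb{Z}_{\ge0}$, $r_{i'}\in\mathbb{Z}_{>0}$; $b_1,\dots,b_M\in\mathbb{C}\setminus\{e_1,e_2,e_3\}$ are pairwise distinct, $\wp(\delta_{i'})=b_{i'}$; $E,s_1,\dots,s_M\in\mathbb{C}$. Set $$v(x)=\sum_{i=0}^3l_i(l_i+1)\wp(x+\omega_i)+\sum_{i'=1}^M\left(\frac{r_{i'}}2\Big(\frac{r_{i'}}2+1\Big)(\wp(x-\delta_{i'})+\wp(x+\delta_{i'}))+\frac{s_{i'}}{\wp(x)-\wp(\delta_{i'})}\right),$$ $$\Psi_g(x)=\prod_{i'=1}^M(\wp(x)-\wp(\delta_{i'}))^{r_{i'}/2},$$ $$H_g=-\frac{d^2}{dx^2}+\sum_{i'=1}^M\frac{r_{i'}\wp'(x)}{\wp(x)-\wp(\delta_{i'})}\frac{d}{dx}+\Big(l_0+\sum_{i'}r_{i'}\Big)\Big(l_0+1-\sum_{i'}r_{i'}\Big)\wp(x)+\sum_{i=1}^3l_i(l_i+1)\wp(x+\omega_i)+\sum_{i'=1}^M\frac{\tilde s_{i'}}{\wp(x)-\wp(\delta_{i'})},$$ $$\tilde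 s_{i'}=s_{i'}-r_{i'}\Big\{\tfrac18r_{i'}(12b_{i'}^2-g_2)+\tfrac12(4b_{i'}^3-g_2b_{i'}-g_3)\sum_{i''\ne i'}\tfrac{r_{i''}}{b_{i'}-b_{i''}}\Big\},\quad C_g=-\tfrac12\sum_{i'}b_{i'}r_{i'}^2+2\Big(\sum_{i'}b_{i'}r_{i'}\Big)\Big(\sum_{i'}r_{i'}\Big).$$ ($f$ solves $-f''+vf=Ef$ iff $f_g=f\Psi_g$ solves $(H_g-E-C_g)f_g=0$.) Standing assumption: the singular points $x=\pm\delta_{i'}$ of $(H_g-E-C_g)f_g=0$ are apparent for all $i'$, i.e. the exponents there are integers and there are no logarithmic solutions (equivalently, the local monodromy is the identity); equivalently, the singular points $z=b_{i'}$, $z=\wp(x)$, of the corresponding Fuchsian equation for $\tilde f(z)=f_g(x)\prod_{i=1}^3(z-e_i)^{l_i/2}$ are apparent. Under this assumption such a $\Xi$ exists. Fixed branches of the square roots and of the integral are chosen. *)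

theory Defs
  imports "HOL-Complex_Analysis.Complex_Analysis"
begin

section \<open>The Weierstrass function with periods $2\omega_1, 2\omega_3$\<close>

definition period_lattice :: "complex \<Rightarrow> complex \<Rightarrow> complex set" where
  "period_lattice \<omega>1 \<omega>3 = {of_int m * (2 * \<omega>1) + of_int n * (2 * \<omega>3) | m n. True}"

definition wp :: "complex \<Rightarrow> complex \<Rightarrow> complex \<Rightarrow> complex" where
  "wp \<omega>1 \<omega>3 x =
     1 / x\<^sup>2 + (\<Sum>\<^sub>\<infinity>w\<in>period_lattice \<omega>1 \<omega>3 - {0}. 1 / (x - w)\<^sup>2 - 1 / w\<^sup>2)"

text \<open>The values of \<open>wp\<close> at lattice points, where the function has poles, are meaningless.\<close>

definition half_period :: "complex \<Rightarrow> complex \<Rightarrow> nat \<Rightarrow> complex" where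
  "half_period \<omega>1 \<omega>3 i =
     (if i = 1 then \<omega>1 else if i = 2 then - \<omega>1 - \<omega>3 else if i = 3 then \<omega>3 else 0)"

definition wp_e :: "complex \<Rightarrow> complex \<Rightarrow> nat \<Rightarrow> complex" where
  "wp_e \<omega>1 \<omega>3 i = wp \<omega>1 \<omega>3 (half_period \<omega>1 \<omega>3 i)"

definition wp_g2 :: "complex \<Rightarrow> complex \<Rightarrow> complex" where
  "wp_g2 \<omega>1 \<omega>3 = - 4 * (wp_e \<omega>1 \<omega>3 1 * wp_e \<omega>1 \<omega>3 2 + wp_e \<omega>1 \<omega>3 2 * wp_e \<omega>1 \<omega>3 3
                          + wp_e \<omega>1 \<omega>3 3 * wp_e \<omega>1 \<omega>3 1)"

definition wp_g3 :: "complex \<Rightarrow> complex \<Rightarrow> complex" where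
  "wp_g3 \<omega>1 \<omega>3 = 4 * wp_e \<omega>1 \<omega>3 1 * wp_e \<omega>1 \<omega>3 2 * wp_e \<omega>1 \<omega>3 3"

section \<open>The two differential operators\<close>

definition potential :: "complex \<Rightarrow> complex \<Rightarrow> (nat \<Rightarrow> nat) \<Rightarrow> nat \<Rightarrow> (nat \<Rightarrow> nat)
    \<Rightarrow> (nat \<Rightarrow> complex) \<Rightarrow> (nat \<Rightarrow> complex) \<Rightarrow> complex \<Rightarrow> complex" where
  "potential \<omega>1 \<omega>3 l M r \<delta> s x =
     (\<Sum>i=0..3. of_nat (l i * (l i + 1)) * wp \<omega>1 \<omega>3 (x + half_period \<omega>1 \<omega>3 i)) +
     (\<Sum>k=1..M. of_nat (r k) / 2 * (of_nat (r k) / 2 + 1)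
                   * (wp \<omega>1 \<omega>3 (x - \<delta> k) + wp \<omega>1 \<omega>3 (x + \<delta> k))
                 + s k / (wp \<omega>1 \<omega>3 x - wp \<omega>1 \<omega>3 (\<delta> k)))"

definition s_tilde :: "complex \<Rightarrow> complex \<Rightarrow> nat \<Rightarrow> (nat \<Rightarrow> nat)
    \<Rightarrow> (nat \<Rightarrow> complex) \<Rightarrow> (nat \<Rightarrow> complex) \<Rightarrow> nat \<Rightarrow> complex" where
  "s_tilde \<omega>1 \<omega>3 M r b s k =
     s k - of_nat (r k) *
       (1 / 8 * of_nat (r k) * (12 * (b k)\<^sup>2 - wp_g2 \<omega>1 \<omega>3)
        + 1 / 2 * (4 * b k ^ 3 - wp_g2 \<omega>1 \<omega>3 * b k - wp_g3 \<omega>1 \<omega>3)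
            * (\<Sum>j\<in>{1..M} - {k}. of_nat (r j) / (b k - b j)))"

definition C_g :: "nat \<Rightarrow> (nat \<Rightarrow> nat) \<Rightarrow> (nat \<Rightarrow> complex) \<Rightarrow> complex" where
  "C_g M r b = - (1 / 2) * (\<Sum>k=1..M. b k * of_nat (r k) ^ 2)
               + 2 * (\<Sum>k=1..M. b k * of_nat (r k)) * (\<Sum>k=1..M. of_nat (r k))"

text \<open>
  \<open>H_g\<close> is $-\frac{d^2}{dx^2} + a(x)\frac{d}{dx} + c(x)$ with \<open>a = H_g_coeff1\<close> and
  \<open>c = H_g_coeff0\<close>.
\<close>

definition H_g_coeff1 :: "complex \<Rightarrow> complex \<Rightarrow> nat \<Rightarrow> (nat \<Rightarrow> nat)
    \<Rightarrow> (nat \<Rightarrow> complex) \<Rightarrow> complex \<Rightarrow> complex" where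
  "H_g_coeff1 \<omega>1 \<omega>3 M r \<delta> x =
     (\<Sum>k=1..M. of_nat (r k) * deriv (wp \<omega>1 \<omega>3) x / (wp \<omega>1 \<omega>3 x - wp \<omega>1 \<omega>3 (\<delta> k)))"

definition H_g_coeff0 :: "complex \<Rightarrow> complex \<Rightarrow> (nat \<Rightarrow> nat) \<Rightarrow> nat \<Rightarrow> (nat \<Rightarrow> nat)
    \<Rightarrow> (nat \<Rightarrow> complex) \<Rightarrow> (nat \<Rightarrow> complex) \<Rightarrow> (nat \<Rightarrow> complex) \<Rightarrow> complex \<Rightarrow> complex" where
  "H_g_coeff0 \<omega>1 \<omega>3 l M r b \<delta> s x =
     (of_nat (l 0) + (\<Sum>k=1..M. of_nat (r k))) * (of_nat (l 0) + 1 - (\<Sum>k=1..M. of_nat (r k)))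
       * wp \<omega>1 \<omega>3 x
     + (\<Sum>i=1..3. of_nat (l i * (l i + 1)) * wp \<omega>1 \<omega>3 (x + half_period \<omega>1 \<omega>3 i))
     + (\<Sum>k=1..M. s_tilde \<omega>1 \<omega>3 M r b s k / (wp \<omega>1 \<omega>3 x - wp \<omega>1 \<omega>3 (\<delta> k)))"

definition H_g :: "complex \<Rightarrow> complex \<Rightarrow> (nat \<Rightarrow> nat) \<Rightarrow> nat \<Rightarrow> (nat \<Rightarrow> nat)
    \<Rightarrow> (nat \<Rightarrow> complex) \<Rightarrow> (nat \<Rightarrow> complex) \<Rightarrow> (nat \<Rightarrow> complex)
    \<Rightarrow> (complex \<Rightarrow> complex) \<Rightarrow> complex \<Rightarrow> complex" where
  "H_g \<omega>1 \<omega>3 l M r b \<delta> s f x =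
     - deriv (deriv f) x + H_g_coeff1 \<omega>1 \<omega>3 M r \<delta> x * deriv f x
     + H_g_coeff0 \<omega>1 \<omega>3 l M r b \<delta> s x * f x"

text \<open>
  The points at which a function occurring in the two equations has a pole.  A half period
  $\omega_i$ with $i \neq 0$ and $l_i = 0$ is not such a point.
\<close>

definition singular_set :: "complex \<Rightarrow> complex \<Rightarrow> (nat \<Rightarrow> nat) \<Rightarrow> nat
    \<Rightarrow> (nat \<Rightarrow> complex) \<Rightarrow> complex set" where
  "singular_set \<omega>1 \<omega>3 l M \<delta> =
     period_lattice \<omega>1 \<omega>3
     \<union> {x. \<exists>i\<in>{1..3}. l i > 0 \<and> x + half_period \<omega>1 \<omega>3 i \<in> period_lattice \<omega>1 \<omega>3}
     \<union> {x. \<exists>k\<in>{1..M}. x - \<delta> k \<in> period_lattice \<omega>1 \<omega>3 \<or> x + \<delta> k \<in> period_lattice \<omega>1 \<omega>3}"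

section \<open>Apparent singularities of $y'' + p y' + q y = 0$\<close>

definition regular_singular_at ::
    "(complex \<Rightarrow> complex) \<Rightarrow> (complex \<Rightarrow> complex) \<Rightarrow> complex \<Rightarrow> bool" where
  "regular_singular_at p q a \<longleftrightarrow>
     (\<exists>\<epsilon>>0. p holomorphic_on ball a \<epsilon> - {a} \<and> q holomorphic_on ball a \<epsilon> - {a})
     \<and> (\<exists>p0. ((\<lambda>x. (x - a) * p x) \<longlongrightarrow> p0) (at a))
     \<and> (\<exists>q0. ((\<lambda>x. (x - a)\<^sup>2 * q x) \<longlongrightarrow> q0) (at a))"

definition exponent_at ::
    "(complex \<Rightarrow> complex) \<Rightarrow> (complex \<Rightarrow> complex) \<Rightarrow> complex \<Rightarrow> complex \<Rightarrow> bool" where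
  "exponent_at p q a \<rho> \<longleftrightarrow>
     (\<exists>p0 q0. ((\<lambda>x. (x - a) * p x) \<longlongrightarrow> p0) (at a) \<and> ((\<lambda>x. (x - a)\<^sup>2 * q x) \<longlongrightarrow> q0) (at a)
        \<and> \<rho> * (\<rho> - 1) + p0 * \<rho> + q0 = 0)"

text \<open>
  When the exponents are integers, every local solution has the form
  $h_1(x) + h_2(x) \log(x-a)$ with $h_1, h_2$ single-valued near $a$; it is logarithmic if
  $h_2 \neq 0$.  It is considered on a disc slit along the branch cut of \<open>Ln\<close>.
\<close>

definition has_logarithmic_solution_at ::
    "(complex \<Rightarrow> complex) \<Rightarrow> (complex \<Rightarrow> complex) \<Rightarrow> complex \<Rightarrow> bool" where
  "has_logarithmic_solution_at p q a \<longleftrightarrow>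
     (\<exists>\<epsilon>>0. \<exists>h1 h2 y.
        h1 holomorphic_on ball a \<epsilon> - {a} \<and> h2 holomorphic_on ball a \<epsilon> - {a}
        \<and> (\<exists>x\<in>ball a \<epsilon> - {a}. h2 x \<noteq> 0)
        \<and> (\<forall>x. y x = h1 x + h2 x * Ln (x - a))
        \<and> (\<forall>x\<in>ball a \<epsilon>. x - a \<notin> \<real>\<^sub>\<le>\<^sub>0 \<longrightarrow> deriv (deriv y) x + p x * deriv y x + q x * y x = 0))"

definition apparent_singularity_at ::
    "(complex \<Rightarrow> complex) \<Rightarrow> (complex \<Rightarrow> complex) \<Rightarrow> complex \<Rightarrow> bool" where
  "apparent_singularity_at p q a \<longleftrightarrow>
     regular_singular_at p q a \<and> (\<forall>\<rho>. exponent_at p q a \<rho> \<longrightarrow> \<rho> \<in> \<int>)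
     \<and> \<not> has_logarithmic_solution_at p q a"

text \<open>
  $(H_g - E - C_g) f = 0$ in the form $f'' + p f' + q f = 0$, and the condition that its
  singular points $\pm\delta_k$ are apparent.
\<close>

definition H_g_apparent :: "complex \<Rightarrow> complex \<Rightarrow> (nat \<Rightarrow> nat) \<Rightarrow> nat \<Rightarrow> (nat \<Rightarrow> nat)
    \<Rightarrow> (nat \<Rightarrow> complex) \<Rightarrow> (nat \<Rightarrow> complex) \<Rightarrow> (nat \<Rightarrow> complex) \<Rightarrow> complex \<Rightarrow> bool" where
  "H_g_apparent \<omega>1 \<omega>3 l M r b \<delta> s E \<longleftrightarrow>
     (\<forall>k\<in>{1..M}. \<forall>a\<in>{\<delta> k, - \<delta> k}.
        apparent_singularity_at
          (\<lambda>x. - H_g_coeff1 \<omega>1 \<omega>3 M r \<delta> x)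
          (\<lambda>x. E + C_g M r b - H_g_coeff0 \<omega>1 \<omega>3 l M r b \<delta> s x) a)"

end

theory Submission
  imports Defs
begin

text \<open>
  The product of two solutions of \<open>f'' = (v - E) f\<close> solves the third-order equation satisfied by
  \<open>\<Xi>\<close>, and \<open>Q\<close> is a first integral of that equation: its derivative is \<open>\<Xi> / 2\<close> times the
  left-hand side.  Hence \<open>Q\<close> is constant on the complement of the singular set, which is connected
  because the singular set is discrete (\<open>first_integral_constant\<close>).  Conversely, put
  \<open>u = \<Xi>' / (2 \<Xi>) + \<surd>(-Q) / \<Xi>\<close>, the logarithmic derivative of the function
  \<open>\<Lambda>\<close> of the theorem.  The definition of \<open>Q\<close> is exactly the Riccati equation
  \<open>u\<^sup>2 + u' = v - E\<close>, which says that \<open>\<Lambda>'' = (v - E) \<Lambda>\<close> (\<open>hermite_ansatz\<close>).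

  The function \<open>\<Psi>\<^sub>g\<close> has logarithmic derivative \<open>a / 2\<close>, where \<open>a\<close> is the
  first-order coefficient of \<open>H\<^sub>g\<close>; multiplication by \<open>\<Psi>\<^sub>g\<close> therefore removes the
  first-order term, and the second equation follows from the first once
  \<open>a\<^sup>2 / 4 - a' / 2 + c = v + C\<^sub>g\<close>, with \<open>c\<close> the zeroth-order coefficient
  (\<open>H_g_coefficients_identity\<close>).  This is a partial fraction identity in \<open>\<wp>(x)\<close>,
  because \<open>\<wp>'\<^sup>2\<close>, \<open>\<wp>''\<close> and \<open>\<wp>(x + \<delta>) + \<wp>(x - \<delta>)\<close>
  are rational functions of \<open>\<wp>(x)\<close>.

  The facts about \<open>\<wp>\<close> all come from one principle: a doubly-periodic function with a finite limit at
  every point is constant (\<open>elliptic_without_poles_constant\<close>).  It gives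
  \<open>\<wp>'' = 6 \<wp>\<^sup>2 + K\<close>, from which \<open>\<wp>'\<^sup>2\<close> is obtained by integration,
  and the addition formula \<open>wp_addition_formula\<close> in a form without denominators.  That formula does
  two further things.  At a point with \<open>\<wp>(x) = \<wp>(\<delta>)\<close> it shows that \<open>x\<close> is
  \<open>\<delta>\<close> or \<open>-\<delta>\<close> modulo periods unless \<open>\<wp>'(\<delta>) = 0\<close>; so
  \<open>\<wp> - b\<^sub>k\<close> has no zeros outside the singular set and \<open>v\<close> is holomorphic there.  For a half
  period \<open>\<delta>\<close> it shows that \<open>e\<^sub>1\<close>, \<open>e\<^sub>2\<close>, \<open>e\<^sub>3\<close> are
  distinct; they are then all the roots of the cubic polynomial in \<open>\<wp>\<close> that equals
  \<open>\<wp>'\<^sup>2\<close>, which identifies its coefficients with \<open>g\<^sub>2\<close> and \<open>g\<^sub>3\<close> as defined from the \<open>e\<^sub>i\<close>.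
\<close>

section \<open>The period lattice and the Weierstrass function\<close>

lemma inverse_square_has_derivative:
  fixes x a :: complex
  assumes "x \<noteq> a"
  shows "((\<lambda>x. 1 / (x - a)\<^sup>2) has_field_derivative - 2 / (x - a) ^ 3) (at x)"
proof -
  define u where "u = x - a"
  have "u \<noteq> 0" using assms by (simp add: u_def)
  then have "((\<lambda>u. 1 / u\<^sup>2) has_field_derivative - 2 / u ^ 3) (at u)"
    by (auto intro!: derivative_eq_intros simp: field_simps power2_eq_square power3_eq_cube)
  then have "((\<lambda>u. 1 / u\<^sup>2) has_field_derivative - 2 / u ^ 3) (at (x + (- a)))"
    by (simp add: u_def)
  then show ?thesis
    unfolding DERIV_shift u_def by simp
qed

text \<open>
  On a bounded set the terms of the series for \<open>\<wp>\<close> and \<open>\<wp>'\<close> are \<open>O(\<bar>w\<bar>\<^sup>-\<^sup>3)\<close>, uniformly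
  for all \<open>w\<close> far enough away; this is the majorant for both series.
\<close>

lemma wp_term_bound:
  fixes y w :: complex
  assumes "norm y < R" "2 * R \<le> norm w"
  shows "norm (1 / (y - w)\<^sup>2 - 1 / w\<^sup>2) \<le> 10 * R * (1 / norm w ^ 3)"
    and "norm (- 2 / (y - w) ^ 3) \<le> 16 * (1 / norm w ^ 3)"
proof -
  have R: "R > 0" using assms(1) norm_ge_zero[of y] by linarith
  have w: "norm w > 0" using R assms(2) by linarith
  have yw: "norm w / 2 \<le> norm (y - w)"
    using norm_triangle_ineq2[of w y] assms by (simp add: norm_minus_commute)
  then have "y \<noteq> w" using w by auto
  have num: "norm (y * (2 * w - y)) \<le> R * (5 / 2 * norm w)"
  proof -
    have "norm (2 * w - y) \<le> 2 * norm w + norm y"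
      using norm_triangle_ineq4[of "2 * w" y] by (simp add: norm_mult)
    then show ?thesis
      unfolding norm_mult using assms R by (intro mult_mono) auto
  qed
  have "1 / (y - w)\<^sup>2 - 1 / w\<^sup>2 = (w\<^sup>2 - (y - w)\<^sup>2) / (w\<^sup>2 * (y - w)\<^sup>2)"
    using \<open>y \<noteq> w\<close> w by (simp add: diff_frac_eq)
  also have "w\<^sup>2 - (y - w)\<^sup>2 = y * (2 * w - y)"
    by (simp add: algebra_simps power2_eq_square)
  finally have "1 / (y - w)\<^sup>2 - 1 / w\<^sup>2 = y * (2 * w - y) / (w\<^sup>2 * (y - w)\<^sup>2)" .
  then have "norm (1 / (y - w)\<^sup>2 - 1 / w\<^sup>2) = norm (y * (2 * w - y)) / (norm w ^ 2 * norm (y - w) ^ 2)"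
    by (simp add: norm_divide norm_mult norm_power)
  also have "\<dots> \<le> R * (5 / 2 * norm w) / (norm w ^ 2 * (norm w / 2) ^ 2)"
    using num yw w R by (intro frac_le mult_left_mono power_mono) auto
  also have "\<dots> = 10 * R * (1 / norm w ^ 3)"
    using w by (simp add: field_simps power2_eq_square power3_eq_cube)
  finally show "norm (1 / (y - w)\<^sup>2 - 1 / w\<^sup>2) \<le> 10 * R * (1 / norm w ^ 3)" .
  have "norm (- 2 / (y - w) ^ 3) = 2 / norm (y - w) ^ 3"
    by (simp add: norm_divide norm_power)
  also have "\<dots> \<le> 2 / (norm w / 2) ^ 3"
    using yw w by (intro frac_le power_mono) auto
  also have "\<dots> = 16 * (1 / norm w ^ 3)"
    by (simp add: power_divide)
  finally show "norm (- 2 / (y - w) ^ 3) \<le> 16 * (1 / norm w ^ 3)" .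
qed

locale period_pair =
  fixes \<omega>1 \<omega>3 :: complex
  assumes periods_indep:
    "\<And>t1 t3 :: real. of_real t1 * \<omega>1 + of_real t3 * \<omega>3 = 0 \<Longrightarrow> t1 = 0 \<and> t3 = 0"
begin

abbreviation lattice (\<open>\<Lambda>\<close>) where "\<Lambda> \<equiv> period_lattice \<omega>1 \<omega>3"
abbreviation weierstrass_p (\<open>\<wp>\<close>) where "\<wp> \<equiv> wp \<omega>1 \<omega>3"

lemma lattice_iff: "w \<in> \<Lambda> \<longleftrightarrow> (\<exists>m n. w = of_int m * (2 * \<omega>1) + of_int n * (2 * \<omega>3))"
  by (auto simp: period_lattice_def)

lemma lattice_0 [simp]: "0 \<in> \<Lambda>"
  unfolding lattice_iff by (rule exI[of _ 0], rule exI[of _ 0]) simp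

lemma lattice_uminus: "- w \<in> \<Lambda>" if "w \<in> \<Lambda>"
proof -
  from that obtain m n where "w = of_int m * (2 * \<omega>1) + of_int n * (2 * \<omega>3)"
    by (auto simp: lattice_iff)
  then have "- w = of_int (- m) * (2 * \<omega>1) + of_int (- n) * (2 * \<omega>3)"
    by simp
  then show ?thesis
    unfolding lattice_iff by blast
qed

lemma lattice_uminus_iff [simp]: "- w \<in> \<Lambda> \<longleftrightarrow> w \<in> \<Lambda>"
  using lattice_uminus[of w] lattice_uminus[of "- w"] by auto

lemma lattice_add: "v + w \<in> \<Lambda>" if "v \<in> \<Lambda>" "w \<in> \<Lambda>"
proof -
  from that obtain m n m' n' where
    "v = of_int m * (2 * \<omega>1) + of_int n * (2 * \<omega>3)"
    "w = of_int m' * (2 * \<omega>1) + of_int n' * (2 * \<omega>3)"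
    by (auto simp: lattice_iff)
  then have "v + w = of_int (m + m') * (2 * \<omega>1) + of_int (n + n') * (2 * \<omega>3)"
    by (simp add: algebra_simps)
  then show ?thesis
    unfolding lattice_iff by blast
qed

lemma lattice_diff: "v \<in> \<Lambda> \<Longrightarrow> w \<in> \<Lambda> \<Longrightarrow> v - w \<in> \<Lambda>"
  using lattice_add[of v "- w"] by simp

lemma lattice_add_iff [simp]: "w \<in> \<Lambda> \<Longrightarrow> x + w \<in> \<Lambda> \<longleftrightarrow> x \<in> \<Lambda>"
  using lattice_add[of x w] lattice_diff[of "x + w" w] by auto

text \<open>
  Linear independence over the reals makes \<open>(s, t) \<mapsto> 2 s \<omega>1 + 2 t \<omega>3\<close> a linear
  isomorphism of the plane, and an injective linear map in finite dimension is bounded below.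
\<close>

lemma real_coordinates:
  obtains B where "B > 0"
    "\<forall>s t. B * max \<bar>s\<bar> \<bar>t\<bar> \<le> norm (of_real s * (2 * \<omega>1) + of_real t * (2 * \<omega>3))"
    "\<forall>z. \<exists>s t. z = of_real s * (2 * \<omega>1) + of_real t * (2 * \<omega>3)"
proof -
  define h :: "complex \<Rightarrow> complex"
    where "h = (\<lambda>z. of_real (Re z) * (2 * \<omega>1) + of_real (Im z) * (2 * \<omega>3))"
  have lin: "linear h"
    by (rule linearI) (auto simp: h_def algebra_simps scaleR_conv_of_real)
  have "inj h"
  proof (rule linear_injective_0[OF lin, THEN iffD2], safe)
    fix z assume "h z = 0"
    then have "2 * (of_real (Re z) * \<omega>1 + of_real (Im z) * \<omega>3) = 0"
      by (simp add: h_def algebra_simps)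
    then have "of_real (Re z) * \<omega>1 + of_real (Im z) * \<omega>3 = 0"
      by (simp only: mult_eq_0_iff) simp
    from periods_indep[OF this] show "z = 0"
      by (simp add: complex_eq_iff)
  qed
  with lin obtain B where B: "B > 0" "\<And>x. B * norm x \<le> norm (h x)"
    using linear_inj_bounded_below_pos by blast
  have surj: "surj h"
    by (rule linear_inj_imp_surj[OF lin \<open>inj h\<close>])
  show ?thesis
  proof (rule that[of B])
    show "\<forall>s t. B * max \<bar>s\<bar> \<bar>t\<bar> \<le> norm (of_real s * (2 * \<omega>1) + of_real t * (2 * \<omega>3))"
    proof (intro allI)
      fix s t :: real
      have "max \<bar>s\<bar> \<bar>t\<bar> \<le> norm (Complex s t)"
        using abs_Re_le_cmod[of "Complex s t"] abs_Im_le_cmod[of "Complex s t"] by simp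
      then have "B * max \<bar>s\<bar> \<bar>t\<bar> \<le> B * norm (Complex s t)"
        using \<open>B > 0\<close> by (intro mult_left_mono) auto
      also have "\<dots> \<le> norm (h (Complex s t))"
        by (rule B(2))
      finally show "B * max \<bar>s\<bar> \<bar>t\<bar> \<le> norm (of_real s * (2 * \<omega>1) + of_real t * (2 * \<omega>3))"
        by (simp add: h_def)
    qed
    show "\<forall>z. \<exists>s t. z = of_real s * (2 * \<omega>1) + of_real t * (2 * \<omega>3)"
    proof
      fix z
      obtain u where "z = h u" using surj by (auto simp: surj_def)
      then show "\<exists>s t. z = of_real s * (2 * \<omega>1) + of_real t * (2 * \<omega>3)"
        by (auto simp: h_def)
    qed
  qed (fact B(1))
qed

lemma lattice_lower_bound:
  obtains B where "B > 0"
    "\<forall>m n. B * real_of_int (max \<bar>m\<bar> \<bar>n\<bar>) \<le> norm (of_int m * (2 * \<omega>1) + of_int n * (2 * \<omega>3))"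
proof -
  obtain B where B: "B > 0"
    "\<forall>s t. B * max \<bar>s\<bar> \<bar>t\<bar> \<le> norm (of_real s * (2 * \<omega>1) + of_real t * (2 * \<omega>3))"
    using real_coordinates by metis
  have "B * real_of_int (max \<bar>m\<bar> \<bar>n\<bar>) \<le> norm (of_int m * (2 * \<omega>1) + of_int n * (2 * \<omega>3))" for m n
    using B(2)[rule_format, of "of_int m" "of_int n"] by (simp add: of_int_max)
  with B(1) show ?thesis
    by (intro that[of B]) auto
qed

lemma finite_lattice_cball: "finite (\<Lambda> \<inter> cball 0 R)"
proof -
  obtain B where B: "B > 0"
    "\<forall>m n. B * real_of_int (max \<bar>m\<bar> \<bar>n\<bar>) \<le> norm (of_int m * (2 * \<omega>1) + of_int n * (2 * \<omega>3))"
    using lattice_lower_bound by metis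
  \<comment> \<open>a bound for the coordinates of all lattice points in the disc\<close>
  define N where "N = \<lceil>R / B\<rceil>"
  have "\<Lambda> \<inter> cball 0 R \<subseteq> (\<lambda>(m, n). of_int m * (2 * \<omega>1) + of_int n * (2 * \<omega>3)) ` ({-N..N} \<times> {-N..N})"
  proof
    fix w assume w: "w \<in> \<Lambda> \<inter> cball 0 R"
    then obtain m n where mn: "w = of_int m * (2 * \<omega>1) + of_int n * (2 * \<omega>3)"
      by (auto simp: lattice_iff)
    have "B * real_of_int (max \<bar>m\<bar> \<bar>n\<bar>) \<le> R"
      using B(2)[rule_format, of m n] w mn by simp
    then have "real_of_int (max \<bar>m\<bar> \<bar>n\<bar>) \<le> R / B"
      using B(1) by (simp add: field_simps)
    then have "max \<bar>m\<bar> \<bar>n\<bar> \<le> N"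
      unfolding N_def by linarith
    then show "w \<in> (\<lambda>(m, n). of_int m * (2 * \<omega>1) + of_int n * (2 * \<omega>3)) ` ({-N..N} \<times> {-N..N})"
      using mn by (intro image_eqI[where x = "(m, n)"]) auto
  qed
  then show ?thesis
    by (rule finite_subset) auto
qed

lemma lattice_sparse: "\<Lambda> sparse_in UNIV"
proof -
  have "\<not> z islimpt \<Lambda>" for z
  proof
    assume "z islimpt \<Lambda>"
    then have "infinite (\<Lambda> \<inter> ball z 1)"
      by (simp add: islimpt_eq_infinite_ball)
    moreover have "\<Lambda> \<inter> ball z 1 \<subseteq> \<Lambda> \<inter> cball 0 (norm z + 1)"
    proof safe
      fix x assume "x \<in> ball z 1"
      then show "x \<in> cball 0 (norm z + 1)"
        using norm_triangle_ineq2[of x z] by (simp add: dist_norm norm_minus_commute)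
    qed
    ultimately show False
      using finite_lattice_cball finite_subset by blast
  qed
  then show ?thesis
    by (simp add: sparse_in_open)
qed

lemma lattice_translate_sparse: "{x. x + a \<in> \<Lambda>} sparse_in UNIV"
proof -
  have "{x. x + a \<in> \<Lambda>} = (+) (- a) ` \<Lambda>"
  proof (rule set_eqI)
    fix x
    have "x \<in> (+) (- a) ` \<Lambda> \<longleftrightarrow> (\<exists>w\<in>\<Lambda>. x + a = w)"
      by (simp add: image_iff eq_diff_eq)
    then show "x \<in> {x. x + a \<in> \<Lambda>} \<longleftrightarrow> x \<in> (+) (- a) ` \<Lambda>"
      by simp
  qed
  then show ?thesis
    using sparse_in_translate_UNIV[OF lattice_sparse, of "- a"] by (simp only:)
qed

lemma open_translate_complement: "open {x. x + a \<notin> \<Lambda>}"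
  using sparse_in_UNIV_imp_closed[OF lattice_translate_sparse[of a]]
  by (simp add: closed_def Collect_neg_eq)

lemma eventually_not_lattice: "\<forall>\<^sub>F x in at z. x + a \<notin> \<Lambda>"
  using lattice_translate_sparse[of a] by (simp add: sparse_in_eventually_iff)

text \<open>
  With \<open>N = max \<bar>m\<bar> \<bar>n\<bar>\<close> the term is \<open>O(N\<^sup>-\<^sup>3)\<close>, and \<open>N\<^sup>-\<^sup>3\<close> splits into two factors
  of exponent \<open>-3/2\<close>, one dominated by a function of \<open>m\<close> and one by a function of \<open>n\<close>.  The
  double series is thus dominated by a product of two convergent series.
\<close>

lemma summable_on_lattice: "(\<lambda>w. 1 / norm w ^ 3) summable_on (\<Lambda> - {0})"
proof -
  obtain B where B: "B > 0"
    "\<forall>m n. B * real_of_int (max \<bar>m\<bar> \<bar>n\<bar>) \<le> norm (of_int m * (2 * \<omega>1) + of_int n * (2 * \<omega>3))"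
    using lattice_lower_bound by metis
  define \<phi> where "\<phi> = (\<lambda>(m, n). of_int m * (2 * \<omega>1) + of_int n * (2 * \<omega>3))"
  define a where "a = (\<lambda>m::int. (1 + real_of_int \<bar>m\<bar>) powr (-(3/2)))"
  have a_pos: "a m > 0" for m
    by (simp add: a_def)
  have "summable (\<lambda>n. real (Suc n) powr (-(3/2)))"
    using summable_Suc_iff[of "\<lambda>n. real n powr (-(3/2))"] summable_real_powr_iff[of "-(3/2)"] by simp
  then have nat: "(\<lambda>n. a (int n)) summable_on UNIV"
    by (subst summable_on_UNIV_nonneg_real_iff) (auto simp: a_def add.commute)
  have "(\<lambda>m. a m) summable_on range int"
    using nat by (subst summable_on_reindex) (auto simp: o_def)
  moreover have "(\<lambda>m. a m) summable_on range (\<lambda>n. - int n)"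
    using nat by (subst summable_on_reindex) (auto simp: o_def a_def inj_on_def)
  moreover have "(UNIV :: int set) = range int \<union> range (\<lambda>n. - int n)"
    by (auto simp: image_iff) (metis int_cases2)
  ultimately have a: "a summable_on UNIV"
    by (metis summable_on_union)
  have "(\<lambda>(m, n). a m * a n) summable_on (UNIV \<times> UNIV)"
    by (rule summable_on_SigmaI[where g = "\<lambda>m. a m * infsum a UNIV"])
      (auto intro!: has_sum_cmult_right summable_on_cmult_left a has_sum_infsum mult_nonneg_nonneg less_imp_le[OF a_pos])
  then have "(\<lambda>p. 8 / B ^ 3 * (case p of (m, n) \<Rightarrow> a m * a n)) summable_on (UNIV - {(0, 0)})"
    by (intro summable_on_cmult_right) (auto elim: summable_on_subset_banach)
  then have "(\<lambda>p. 1 / norm (\<phi> p) ^ 3) summable_on (UNIV - {(0, 0)})"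
  proof (rule summable_on_comparison_test)
    fix p :: "int \<times> int" assume "p \<in> UNIV - {(0, 0)}"
    then obtain m n where p: "p = (m, n)" and "(m, n) \<noteq> (0, 0)" by (cases p) auto
    define N where "N = max \<bar>m\<bar> \<bar>n\<bar>"
    have N: "N \<ge> 1" "\<bar>m\<bar> \<le> N" "\<bar>n\<bar> \<le> N"
      using \<open>(m, n) \<noteq> (0, 0)\<close> by (auto simp: N_def)
    \<comment> \<open>\<open>1 + \<bar>k\<bar> \<le> 2 N\<close>, since \<open>N \<ge> 1\<close>\<close>
    have aN: "a k \<ge> (2 * real_of_int N) powr (-(3/2))" if "\<bar>k\<bar> \<le> N" for k
      unfolding a_def using that N(1) by (intro powr_mono2') auto
    have "1 / norm (\<phi> p) ^ 3 \<le> 1 / (B * real_of_int N) ^ 3"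
      using B N(1) by (intro divide_left_mono power_mono)
        (auto simp: p \<phi>_def N_def intro!: mult_pos_pos zero_less_power
              intro: less_le_trans[OF _ B(2)[rule_format, of m n]])
    also have "\<dots> = 8 / B ^ 3 * ((2 * real_of_int N) powr (-(3/2)) * (2 * real_of_int N) powr (-(3/2)))"
    proof -
      have "(2 * real_of_int N) powr (-(3/2)) * (2 * real_of_int N) powr (-(3/2))
          = (2 * real_of_int N) powr (- real 3)"
        by (simp flip: powr_add)
      also have "\<dots> = 1 / (2 * real_of_int N) ^ 3"
        using N(1) by (subst powr_minus, subst powr_realpow) (auto simp: field_simps)
      finally show ?thesis
        by (simp add: power_mult_distrib)
    qed
    also have "\<dots> \<le> 8 / B ^ 3 * (a m * a n)"
      using B(1) N aN[of m] aN[of n] less_imp_le[OF a_pos] by (intro mult_left_mono mult_mono) auto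
    finally show "1 / norm (\<phi> p) ^ 3 \<le> 8 / B ^ 3 * (case p of (m, n) \<Rightarrow> a m * a n)"
      by (simp add: p)
  qed auto
  moreover have "bij_betw \<phi> (UNIV - {(0, 0)}) (\<Lambda> - {0})"
  proof (rule bij_betw_imageI)
    have eq: "m = m' \<and> n = n'" if "\<phi> (m, n) = \<phi> (m', n')" for m n m' n'
    proof -
      have "B * real_of_int (max \<bar>m - m'\<bar> \<bar>n - n'\<bar>) \<le> norm (\<phi> (m, n) - \<phi> (m', n'))"
        using B(2)[rule_format, of "m - m'" "n - n'"] by (simp add: \<phi>_def algebra_simps)
      also have "\<dots> = 0" using that by simp
      finally have "max \<bar>m - m'\<bar> \<bar>n - n'\<bar> \<le> 0"
        using B(1) by (simp add: mult_le_0_iff)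
      then show ?thesis by auto
    qed
    then show "inj_on \<phi> (UNIV - {(0, 0)})"
      by (auto simp: inj_on_def)
    have "\<phi> (m, n) \<noteq> 0" if "(m, n) \<noteq> (0, 0)" for m n
      using eq[of m n 0 0] that by (auto simp: \<phi>_def)
    moreover have "\<Lambda> = range \<phi>"
      by (simp add: set_eq_iff lattice_iff image_iff \<phi>_def)
    moreover have "\<phi> (0, 0) = 0"
      by (simp add: \<phi>_def)
    ultimately show "\<phi> ` (UNIV - {(0, 0)}) = \<Lambda> - {0}"
      by auto
  qed
  ultimately show ?thesis
    by (subst summable_on_reindex_bij_betw[symmetric]) auto
qed


lemma infinite_lattice: "infinite (\<Lambda> - {0})"
proof -
  have "2 * \<omega>1 \<noteq> 0"
    using periods_indep[of 1 0] by auto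
  have "inj (\<lambda>n. of_nat (Suc n) * (2 * \<omega>1))"
    using \<open>2 * \<omega>1 \<noteq> 0\<close> by (auto simp: inj_def simp del: of_nat_Suc)
  moreover have "range (\<lambda>n. of_nat (Suc n) * (2 * \<omega>1)) \<subseteq> \<Lambda> - {0}"
  proof safe
    fix n
    have "of_nat (Suc n) * (2 * \<omega>1) = of_int (int (Suc n)) * (2 * \<omega>1) + of_int 0 * (2 * \<omega>3)"
      by simp
    then show "of_nat (Suc n) * (2 * \<omega>1) \<in> \<Lambda>"
      unfolding lattice_iff by blast
  qed (use \<open>2 * \<omega>1 \<noteq> 0\<close> in \<open>auto simp del: of_nat_Suc\<close>)
  ultimately show ?thesis
    using finite_subset range_inj_infinite by blast
qed

text \<open>
  What remains of \<open>\<wp>\<close> after its principal part at the origin is removed; it is holomorphic at the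
  origin, where \<open>\<wp>\<close> itself has a pole.
\<close>

definition wp_regular :: "complex \<Rightarrow> complex" where
  "wp_regular x = (\<Sum>\<^sub>\<infinity>w\<in>\<Lambda> - {0}. 1 / (x - w)\<^sup>2 - 1 / w\<^sup>2)"

lemma wp_eq: "\<wp> x = 1 / x\<^sup>2 + wp_regular x"
  by (simp add: wp_def wp_regular_def)

lemma open_Compl_lattice: "open (- \<Lambda>)" "open (- (\<Lambda> - {0}))"
proof -
  show "open (- \<Lambda>)"
    using sparse_in_UNIV_imp_closed[OF lattice_sparse] by (simp add: closed_def)
  have "\<Lambda> - {0} sparse_in UNIV"
    by (rule sparse_in_subset2[OF lattice_sparse]) auto
  then show "open (- (\<Lambda> - {0}))"
    by (metis sparse_in_UNIV_imp_closed open_Compl)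
qed

text \<open>
  Termwise differentiation.  The lattice is enumerated as a sequence; since only finitely many
  lattice points lie in any disc, the majorant applies to all but finitely many terms near a given
  point, so no lattice point has to be treated separately.
\<close>

lemma wp_regular_has_derivative:
  assumes "x \<notin> \<Lambda> - {0}"
  shows "\<exists>D. ((\<lambda>w. - 2 / (x - w) ^ 3) has_sum D) (\<Lambda> - {0}) \<and>
    (wp_regular has_field_derivative D) (at x)"
proof -
  define S where "S = - (\<Lambda> - {0})"
  define w where "w = from_nat_into (\<Lambda> - {0})"
  have "countable (\<Lambda> - {0})"
    using sparse_imp_countable[OF open_UNIV lattice_sparse] by simp
  then have bij: "bij_betw w UNIV (\<Lambda> - {0})"
    unfolding w_def using infinite_lattice by (rule bij_betw_from_nat_into)
  have summ: "summable (\<lambda>n. 1 / norm (w n) ^ 3)"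
    using summable_on_lattice summable_on_reindex_bij_betw[OF bij, of "\<lambda>w. 1 / norm w ^ 3"]
    by (simp add: summable_on_UNIV_nonneg_real_iff)
  have large: "\<forall>\<^sub>F n in sequentially. 2 * R \<le> norm (w n)" for R
  proof -
    have "finite (w -` (\<Lambda> \<inter> cball 0 (2 * R)))"
      using bij finite_lattice_cball by (intro finite_vimageI) (auto simp: bij_betw_def)
    moreover have "{n. \<not> 2 * R \<le> norm (w n)} \<subseteq> w -` (\<Lambda> \<inter> cball 0 (2 * R))"
      using bij by (auto simp: bij_betw_def)
    ultimately have "finite {n. \<not> 2 * R \<le> norm (w n)}"
      by (rule rev_finite_subset)
    then show ?thesis
      by (simp add: eventually_cofinite flip: cofinite_eq_sequentially)
  qed
  define f where "f = (\<lambda>n x. 1 / (x - w n)\<^sup>2 - 1 / (w n)\<^sup>2)"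
  define f' where "f' = (\<lambda>n x. - 2 / (x - w n) ^ 3)"
  have "\<exists>g g'. \<forall>x\<in>S. (\<lambda>n. f n x) sums g x \<and> (\<lambda>n. f' n x) sums g' x \<and>
           (g has_field_derivative g' x) (at x)"
  proof (rule series_and_derivative_comparison_local)
    show "open S"
      unfolding S_def by (rule open_Compl_lattice)
  next
    fix n x assume "x \<in> S"
    then have "x \<noteq> w n"
      using bij by (auto simp: S_def bij_betw_def)
    then show "(f n has_field_derivative f' n x) (at x)"
      unfolding f_def f'_def
      using DERIV_diff[OF inverse_square_has_derivative DERIV_const] by simp
  next
    fix x assume "x \<in> S"
    define R where "R = norm x + 1"
    have in_ball: "norm y < R" if "y \<in> ball x 1" for y
      using that norm_triangle_ineq2[of y x] by (simp add: R_def dist_norm norm_minus_commute)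
    have "\<forall>y\<in>ball x 1 \<inter> S. norm (f n y) \<le> 10 * R * (1 / norm (w n) ^ 3)"
      if "2 * R \<le> norm (w n)" for n
      unfolding f_def by (intro ballI wp_term_bound(1) that) (use in_ball in auto)
    then have "\<forall>\<^sub>F n in sequentially. \<forall>y\<in>ball x 1 \<inter> S. norm (f n y) \<le> 10 * R * (1 / norm (w n) ^ 3)"
      by (rule eventually_mono[OF large])
    then show "\<exists>d h. 0 < d \<and> summable h \<and>
        (\<forall>\<^sub>F n in sequentially. \<forall>y\<in>ball x d \<inter> S. norm (f n y) \<le> h n)"
      using summable_mult[OF summ, of "10 * R"] by (intro exI[of _ 1]) auto
  qed
  then obtain g g' where g: "\<And>x. x \<in> S \<Longrightarrow> (\<lambda>n. f n x) sums g x"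
      "\<And>x. x \<in> S \<Longrightarrow> (\<lambda>n. f' n x) sums g' x"
      "\<And>x. x \<in> S \<Longrightarrow> (g has_field_derivative g' x) (at x)"
    by blast
  have abs: "summable (\<lambda>n. norm (f n x))" "summable (\<lambda>n. norm (f' n x))" for x
  proof -
    have "\<forall>\<^sub>F n in sequentially. norm (norm (f n x)) \<le> 10 * (norm x + 1) * (1 / norm (w n) ^ 3)"
      using large[of "norm x + 1"] unfolding f_def real_norm_def abs_norm_cancel
      by eventually_elim (rule wp_term_bound(1); simp)
    then show "summable (\<lambda>n. norm (f n x))"
      by (rule summable_comparison_test_ev) (intro summable_mult summ)
    have "\<forall>\<^sub>F n in sequentially. norm (norm (f' n x)) \<le> 16 * (1 / norm (w n) ^ 3)"
      using large[of "norm x + 1"] unfolding f'_def real_norm_def abs_norm_cancel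
      by eventually_elim (rule wp_term_bound(2)[of _ "norm x + 1"]; simp)
    then show "summable (\<lambda>n. norm (f' n x))"
      by (rule summable_comparison_test_ev) (intro summable_mult summ)
  qed
  have reg: "g y = wp_regular y" if "y \<in> S" for y
  proof -
    have "((\<lambda>n. f n y) has_sum g y) UNIV"
      by (rule norm_summable_imp_has_sum[OF abs(1) g(1)[OF that]])
    then have "((\<lambda>w. 1 / (y - w)\<^sup>2 - 1 / w\<^sup>2) has_sum g y) (\<Lambda> - {0})"
      unfolding f_def by (subst (asm) has_sum_reindex_bij_betw[OF bij])
    then show ?thesis
      by (simp add: wp_regular_def infsumI)
  qed
  have "x \<in> S"
    using assms unfolding S_def by blast
  have "((\<lambda>n. f' n x) has_sum g' x) UNIV"
    by (rule norm_summable_imp_has_sum[OF abs(2) g(2)[OF \<open>x \<in> S\<close>]])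
  then have "((\<lambda>w. - 2 / (x - w) ^ 3) has_sum g' x) (\<Lambda> - {0})"
    unfolding f'_def by (subst (asm) has_sum_reindex_bij_betw[OF bij])
  moreover have "(wp_regular has_field_derivative g' x) (at x)"
    by (rule has_field_derivative_transform_within_open[OF g(3)[OF \<open>x \<in> S\<close>] _ \<open>x \<in> S\<close> reg])
      (simp_all only: S_def open_Compl_lattice)
  ultimately show ?thesis
    by blast
qed

lemma wp_regular_holomorphic: "wp_regular holomorphic_on - (\<Lambda> - {0})"
  unfolding holomorphic_on_open[OF open_Compl_lattice(2)]
proof
  fix x assume "x \<in> - (\<Lambda> - {0})"
  then have "x \<notin> \<Lambda> - {0}" by blast
  then show "\<exists>D. (wp_regular has_field_derivative D) (at x)"
    using wp_regular_has_derivative by blast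
qed

text \<open>
  The principal part at the origin supplies the term for \<open>w = 0\<close>, so that the derivative is a sum
  over the whole lattice and its periodicity is a reindexing.
\<close>

lemma wp_has_derivative:
  assumes "x \<notin> \<Lambda>"
  shows "(\<wp> has_field_derivative (\<Sum>\<^sub>\<infinity>w\<in>\<Lambda>. - 2 / (x - w) ^ 3)) (at x)"
proof -
  have "x \<notin> \<Lambda> - {0}" using assms by simp
  then obtain D where D: "((\<lambda>w. - 2 / (x - w) ^ 3) has_sum D) (\<Lambda> - {0})"
    "(wp_regular has_field_derivative D) (at x)"
    using wp_regular_has_derivative by blast
  have "x \<noteq> 0" using assms by auto
  have "((\<lambda>w. - 2 / (x - w) ^ 3) has_sum (- 2 / (x - 0) ^ 3 + D)) (insert 0 (\<Lambda> - {0}))"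
    by (rule has_sum_insert[OF _ D(1)]) auto
  moreover have "insert 0 (\<Lambda> - {0}) = \<Lambda>"
    by auto
  ultimately have sum: "(\<Sum>\<^sub>\<infinity>w\<in>\<Lambda>. - 2 / (x - w) ^ 3) = - 2 / x ^ 3 + D"
    using infsumI by fastforce
  have "((\<lambda>x. 1 / x\<^sup>2 + wp_regular x) has_field_derivative (- 2 / x ^ 3 + D)) (at x)"
    using \<open>x \<noteq> 0\<close> D(2)
    by (auto intro!: derivative_eq_intros simp: field_simps power2_eq_square power3_eq_cube)
  then show ?thesis
    unfolding sum by (simp add: wp_eq[abs_def])
qed

lemma wp_DERIV: "x \<notin> \<Lambda> \<Longrightarrow> (\<wp> has_field_derivative deriv \<wp> x) (at x)"
  using wp_has_derivative[of x] by (simp add: DERIV_imp_deriv[OF wp_has_derivative])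

lemma wp_holomorphic: "\<wp> holomorphic_on - \<Lambda>"
  unfolding holomorphic_on_open[OF open_Compl_lattice(1)]
  using wp_has_derivative by blast

lemma wp_regular_even: "wp_regular (- x) = wp_regular x"
  unfolding wp_regular_def
  by (rule infsum_reindex_bij_witness[of _ uminus uminus])
    (auto simp: power2_eq_square algebra_simps)

lemma wp_even: "\<wp> (- x) = \<wp> x"
  by (simp add: wp_eq wp_regular_even)

lemma deriv_wp_periodic:
  assumes "w \<in> \<Lambda>" "x \<notin> \<Lambda>"
  shows "deriv \<wp> (x + w) = deriv \<wp> x"
proof -
  have "(\<Sum>\<^sub>\<infinity>u\<in>\<Lambda>. - 2 / (x + w - u) ^ 3) = (\<Sum>\<^sub>\<infinity>u\<in>\<Lambda>. - 2 / (x - u) ^ 3)"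
    by (rule infsum_reindex_bij_witness[of _ "\<lambda>u. u + w" "\<lambda>u. u - w"])
      (use assms in \<open>auto simp: lattice_diff lattice_add algebra_simps\<close>)
  then show ?thesis
    using assms by (simp add: DERIV_imp_deriv[OF wp_has_derivative])
qed

lemma connected_Compl_lattice: "connected (- \<Lambda>)"
  using sparse_imp_connected[OF _ connected_UNIV open_UNIV lattice_sparse]
  by (simp add: Compl_eq_Diff_UNIV)

text \<open>
  As \<open>\<wp>'\<close> is periodic, \<open>\<wp> (x + w) - \<wp> x\<close> is constant; replacing \<open>x\<close> by \<open>- x - w\<close> changes its
  sign because \<open>\<wp>\<close> is even.
\<close>

lemma wp_periodic:
  assumes "w \<in> \<Lambda>" "x \<notin> \<Lambda>"
  shows "\<wp> (x + w) = \<wp> x"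
proof -
  have deriv: "((\<lambda>x. \<wp> (x + w) - \<wp> x) has_field_derivative 0) (at x)" if "x \<notin> \<Lambda>" for x
  proof -
    have "x + w \<notin> \<Lambda>"
      using that assms(1) by simp
    then have shift: "(\<wp> has_field_derivative deriv \<wp> (x + w)) (at (x + w))"
      and base: "(\<wp> has_field_derivative deriv \<wp> x) (at x)"
      using that by (simp_all add: wp_DERIV)
    have "((\<lambda>x. \<wp> (x + w)) has_field_derivative deriv \<wp> x) (at x)"
      using shift deriv_wp_periodic[OF assms(1) that] by (simp add: DERIV_shift)
    from DERIV_diff[OF this base] show ?thesis
      by simp
  qed
  then have "continuous_on (- \<Lambda>) (\<lambda>x. \<wp> (x + w) - \<wp> x)"
    by (intro continuous_at_imp_continuous_on) (auto intro: DERIV_isCont)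
  then have "(\<lambda>x. \<wp> (x + w) - \<wp> x) constant_on - \<Lambda>"
    by (rule DERIV_zero_connected_constant_on[OF connected_Compl_lattice
          open_Compl_lattice(1) finite.emptyI]) (use deriv in auto)
  then obtain c where c: "\<And>x. x \<in> - \<Lambda> \<Longrightarrow> \<wp> (x + w) - \<wp> x = c"
    by (auto simp: constant_on_def)
  have "- (x + w) \<notin> \<Lambda>"
    using assms by (metis lattice_add_iff lattice_uminus_iff)
  then have "\<wp> (- (x + w) + w) - \<wp> (- (x + w)) = c"
    by (intro c) simp
  moreover have "\<wp> (- (x + w) + w) = \<wp> x"
    using wp_even[of x] by simp
  ultimately have "\<wp> x - \<wp> (x + w) = c"
    using wp_even[of "x + w"] by simp
  moreover have "\<wp> (x + w) - \<wp> x = c"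
    using c assms(2) by simp
  ultimately have "\<wp> (x + w) - \<wp> x = - (\<wp> (x + w) - \<wp> x)"
    by (metis minus_diff_eq)
  then show ?thesis
    by (simp only: eq_neg_iff_add_eq_0 mult_2[symmetric]) simp
qed

end

section \<open>Elliptic functions without poles and the differential equations\<close>

lemma holomorphic_factor_square:
  fixes g :: "complex \<Rightarrow> complex"
  assumes "g holomorphic_on S" "open S" "a \<in> S" "deriv g a = 0"
  obtains h where "h holomorphic_on S" "\<And>x. x \<in> S \<Longrightarrow> g x = g a + (x - a)\<^sup>2 * h x"
proof -
  define k where "k = (\<lambda>z. if z = a then deriv g a else (g z - g a) / (z - a))"
  define h where "h = (\<lambda>z. if z = a then deriv k a else (k z - k a) / (z - a))"
  have "k holomorphic_on S"
    unfolding k_def using assms(1,2) by (rule pole_lemma_open)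
  then have "h holomorphic_on S"
    unfolding h_def using assms(2) by (rule pole_lemma_open)
  moreover have "g x = g a + (x - a)\<^sup>2 * h x" for x
    using assms(4) by (simp add: h_def k_def power2_eq_square)
  ultimately show ?thesis
    by (rule that)
qed

text \<open>
  The derivative of an even function vanishes at the origin.
\<close>

lemma even_holomorphic_factor_square:
  fixes g :: "complex \<Rightarrow> complex"
  assumes hol: "g holomorphic_on ball 0 r" and "r > 0"
    and even: "\<And>x. x \<in> ball 0 r \<Longrightarrow> g (- x) = g x"
  shows "\<exists>h. h holomorphic_on ball 0 r \<and> (\<forall>x\<in>ball 0 r. g x = g 0 + x\<^sup>2 * h x) \<and>
    (\<forall>x\<in>ball 0 r. h (- x) = h x)"
proof -
  have 0: "0 \<in> ball (0::complex) r" using \<open>r > 0\<close> by simp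
  have d: "(g has_field_derivative deriv g 0) (at (- 0))"
    using holomorphic_derivI[OF hol _ 0] by simp
  have "((\<lambda>x. g (- x)) has_field_derivative deriv g 0 * (- 1)) (at 0)"
    by (rule DERIV_chain2[where f = g and g = uminus, OF d]) (auto intro!: derivative_eq_intros)
  then have "(g has_field_derivative deriv g 0 * (- 1)) (at 0)"
    by (rule has_field_derivative_transform_within_open[OF _ open_ball 0]) (rule even)
  from DERIV_unique[OF d[unfolded minus_zero] this] have "deriv g 0 = deriv g 0 * (- 1)" .
  then have "deriv g 0 = 0"
    by (simp add: eq_neg_iff_add_eq_0 flip: mult_2)
  then obtain h where h: "h holomorphic_on ball 0 r"
    "\<And>x. x \<in> ball 0 r \<Longrightarrow> g x = g 0 + (x - 0)\<^sup>2 * h x"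
    using holomorphic_factor_square[OF hol open_ball 0] by metis
  have "h (- x) = h x" if "x \<in> ball 0 r" for x
    using h(2)[of x] h(2)[of "- x"] even[OF that] that by (cases "x = 0") auto
  with h show ?thesis
    by (intro exI[of _ h]) auto
qed

context period_pair
begin

lemma periodic_tendsto:
  fixes f :: "complex \<Rightarrow> complex"
  assumes "D sparse_in UNIV" "\<And>x. x \<notin> D \<Longrightarrow> f (x + w) = f x" "(f \<longlongrightarrow> L) (at z)"
  shows "(f \<longlongrightarrow> L) (at (z + w))"
proof -
  have "\<forall>\<^sub>F x in at z. x \<notin> D"
    using assms(1) by (simp add: sparse_in_eventually_iff)
  then have "\<forall>\<^sub>F x in at z. f x = f (x + w)"
    by eventually_elim (simp add: assms(2))
  then have "((\<lambda>x. f (x + w)) \<longlongrightarrow> L) (at z)"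
    using assms(3) by (rule Lim_transform_eventually[rotated])
  then show ?thesis
    using LIM_offset[of "\<lambda>x. f (x + w)" L z "- w"] by simp
qed

text \<open>
  Once its singularities are removed, \<open>f\<close> is entire and takes all its values on one compact period
  parallelogram, so Liouville's theorem applies.  On \<open>D\<close> only limits of \<open>f\<close> are
  prescribed, because the values of \<open>\<wp>\<close> at lattice points are not its limits.
\<close>

lemma elliptic_without_poles_constant:
  assumes hol: "f holomorphic_on - D" and D: "D sparse_in UNIV"
    and per: "\<And>x w. x \<notin> D \<Longrightarrow> w \<in> \<Lambda> \<Longrightarrow> f (x + w) = f x"
    and lim: "\<And>z. z \<in> D \<Longrightarrow> \<exists>L. (f \<longlongrightarrow> L) (at z)"
  shows "f constant_on - D"
proof -
  define F where "F = remove_sings f"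
  have "open (- D)"
    by (intro open_Compl sparse_in_UNIV_imp_closed D)
  then have analytic: "f analytic_on {z}" if "z \<notin> D" for z
    using hol that by (intro holomorphic_on_imp_analytic_at) auto
  have lim': "\<exists>L. (f \<longlongrightarrow> L) (at z)" for z
    using lim analytic by (metis analytic_at_imp_isCont isCont_def)
  have "F analytic_on {z}" for z
  proof -
    have "\<forall>\<^sub>F x in at z. x \<notin> D"
      using D by (simp add: sparse_in_eventually_iff)
    then obtain r where r: "r > 0" "\<And>x. x \<in> ball z r - {z} \<Longrightarrow> x \<notin> D"
      by (auto simp: eventually_at dist_commute)
    have "f analytic_on ball z r - {z}"
      by (subst analytic_on_analytic_at) (use r(2) analytic in blast)
    with r(1) have "isolated_singularity_at f z"
      unfolding isolated_singularity_at_def by blast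
    with lim' show ?thesis
      unfolding F_def by (auto intro: remove_sings_analytic_at)
  qed
  then have "F analytic_on UNIV"
    by (subst analytic_on_analytic_at) blast
  then have F_hol: "F holomorphic_on UNIV"
    by (rule analytic_imp_holomorphic)
  have F_per: "F (z + w) = F z" if "w \<in> \<Lambda>" for z w
  proof -
    obtain L where L: "(f \<longlongrightarrow> L) (at z)"
      using lim' by blast
    have "(f \<longlongrightarrow> L) (at (z + w))"
      by (rule periodic_tendsto[OF D per[OF _ that] L])
    with L show ?thesis
      unfolding F_def by (simp add: remove_sings_eqI)
  qed
  define K where "K = (\<lambda>p. of_real (fst p) * (2 * \<omega>1) + of_real (snd p) * (2 * \<omega>3)) ` ({0..1} \<times> {0..1::real})"
  have "compact K"
    unfolding K_def
    by (intro compact_continuous_image compact_Times continuous_intros) auto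
  then have "compact (F ` K)"
    using F_hol by (intro compact_continuous_image)
      (auto intro: holomorphic_on_imp_continuous_on holomorphic_on_subset)
  moreover have "range F \<subseteq> F ` K"
  proof safe
    fix z
    obtain s t where z: "z = of_real s * (2 * \<omega>1) + of_real t * (2 * \<omega>3)"
      using real_coordinates by metis
    define w where "w = of_int \<lfloor>s\<rfloor> * (2 * \<omega>1) + of_int \<lfloor>t\<rfloor> * (2 * \<omega>3)"
    have "w \<in> \<Lambda>"
      unfolding w_def lattice_iff by blast
    have "z - w = of_real (frac s) * (2 * \<omega>1) + of_real (frac t) * (2 * \<omega>3)"
      unfolding z w_def frac_def by (simp add: algebra_simps)
    then have "z - w \<in> K"
      unfolding K_def using frac_lt_1[of s] frac_lt_1[of t]
      by (intro image_eqI[of _ _ "(frac s, frac t)"]) (auto simp: less_imp_le)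
    moreover have "F z = F (z - w)"
      using F_per[OF \<open>w \<in> \<Lambda>\<close>, of "z - w"] by simp
    ultimately show "F z \<in> F ` K"
      by blast
  qed
  ultimately have "bounded (range F)"
    by (meson bounded_subset compact_imp_bounded)
  then obtain c where "\<And>z. F z = c"
    using Liouville_theorem[OF F_hol] by (auto simp: constant_on_def)
  then have "f x = c" if "x \<notin> D" for x
    using remove_sings_at_analytic[OF analytic[OF that]] unfolding F_def by simp
  then show ?thesis
    by (auto simp: constant_on_def)
qed

lemma punctured_ball_avoiding_lattice:
  obtains r where "r > 0" "\<And>x. x \<in> ball a r - {a} \<Longrightarrow> x \<notin> \<Lambda>"
proof -
  have "\<forall>\<^sub>F x in at a. x \<notin> \<Lambda>"
    using eventually_not_lattice[of 0 a] by simp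
  then show ?thesis
    using that by (auto simp: eventually_at dist_commute)
qed

lemma wp_regular_0: "wp_regular 0 = 0"
  by (simp add: wp_regular_def)

lemma wp_near_0:
  "\<exists>r h. r > 0 \<and> (\<forall>x\<in>ball 0 r - {0}. x \<notin> \<Lambda>) \<and> wp_regular holomorphic_on ball 0 r \<and>
     h holomorphic_on ball 0 r \<and> (\<forall>x\<in>ball 0 r. wp_regular x = x\<^sup>2 * h x)"
proof -
  obtain r where r: "r > 0" "\<And>x. x \<in> ball 0 r - {0} \<Longrightarrow> x \<notin> \<Lambda>"
    using punctured_ball_avoiding_lattice[of 0] by metis
  have hol: "wp_regular holomorphic_on ball 0 r"
    by (rule holomorphic_on_subset[OF wp_regular_holomorphic]) (use r in auto)
  obtain h where h: "h holomorphic_on ball 0 r"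
    "\<And>x. x \<in> ball 0 r \<Longrightarrow> wp_regular x = wp_regular 0 + x\<^sup>2 * h x"
    using even_holomorphic_factor_square[OF hol r(1) wp_regular_even] by blast
  show ?thesis
    by (intro exI[of _ r] exI[of _ h] conjI) (use r hol h wp_regular_0 in auto)
qed

lemma deriv_wp_holomorphic: "deriv \<wp> holomorphic_on - \<Lambda>"
  "deriv (deriv \<wp>) holomorphic_on - \<Lambda>"
  using wp_holomorphic open_Compl_lattice(1) by (auto intro!: holomorphic_deriv)

lemma wp_DERIV2: "x \<notin> \<Lambda> \<Longrightarrow> (deriv \<wp> has_field_derivative deriv (deriv \<wp>) x) (at x)"
  using holomorphic_derivI[OF deriv_wp_holomorphic(1) open_Compl_lattice(1)] by simp

lemma deriv2_wp_periodic:
  assumes "w \<in> \<Lambda>" "x \<notin> \<Lambda>"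
  shows "deriv (deriv \<wp>) (x + w) = deriv (deriv \<wp>) x"
proof -
  have "(deriv \<wp> has_field_derivative deriv (deriv \<wp>) (x + w)) (at (x + w))"
    using assms by (intro wp_DERIV2) simp
  then have "((\<lambda>x. deriv \<wp> (x + w)) has_field_derivative deriv (deriv \<wp>) (x + w)) (at x)"
    by (simp add: DERIV_shift)
  then have "(deriv \<wp> has_field_derivative deriv (deriv \<wp>) (x + w)) (at x)"
    by (rule has_field_derivative_transform_within_open[OF _ open_Compl_lattice(1)])
      (use assms deriv_wp_periodic in auto)
  then show ?thesis
    by (simp add: DERIV_imp_deriv)
qed

lemma deriv_wp_odd:
  assumes "x \<notin> \<Lambda>"
  shows "deriv \<wp> (- x) = - deriv \<wp> x"
proof -
  have "(\<wp> has_field_derivative deriv \<wp> (- x)) (at (- x))"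
    using assms by (intro wp_DERIV) simp
  then have "((\<lambda>x. \<wp> (- x)) has_field_derivative deriv \<wp> (- x) * (- 1)) (at x)"
    by (rule DERIV_chain2) (auto intro!: derivative_eq_intros)
  then have "(\<wp> has_field_derivative - deriv \<wp> (- x)) (at x)"
    by (simp add: wp_even)
  then show ?thesis
    by (simp add: DERIV_imp_deriv)
qed

text \<open>
  Near the origin \<open>\<wp> = x\<^sup>-\<^sup>2 + R\<close>, and the poles \<open>6 x\<^sup>-\<^sup>4\<close> of \<open>\<wp>''\<close> and of \<open>6 \<wp>\<^sup>2\<close> cancel.  The
  remaining cross term \<open>12 x\<^sup>-\<^sup>2 R\<close> is harmless since \<open>R\<close> has a double zero, so the difference
  extends holomorphically and is constant.
\<close>

lemma wp_second_order_ode: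
  obtains K where "\<And>x. x \<notin> \<Lambda> \<Longrightarrow> deriv (deriv \<wp>) x = 6 * (\<wp> x)\<^sup>2 + K"
proof -
  define f where "f = (\<lambda>x. deriv (deriv \<wp>) x - 6 * (\<wp> x)\<^sup>2)"
  have hol: "f holomorphic_on - \<Lambda>"
    unfolding f_def by (intro holomorphic_intros wp_holomorphic deriv_wp_holomorphic)
  have per: "f (x + w) = f x" if "x \<notin> \<Lambda>" "w \<in> \<Lambda>" for x w
    using that by (simp add: f_def wp_periodic deriv2_wp_periodic)
  obtain r h where r: "r > 0" "\<And>x. x \<in> ball 0 r - {0} \<Longrightarrow> x \<notin> \<Lambda>"
    and R: "wp_regular holomorphic_on ball 0 r"
    and h: "h holomorphic_on ball 0 r" "\<And>x. x \<in> ball 0 r \<Longrightarrow> wp_regular x = x\<^sup>2 * h x"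
    using wp_near_0 by blast
  define A where "A = ball (0::complex) r - {0}"
  have "open A" by (auto simp: A_def)
  define R2 where "R2 = deriv (deriv wp_regular)"
  have R_deriv: "(wp_regular has_field_derivative deriv wp_regular x) (at x)"
      "(deriv wp_regular has_field_derivative R2 x) (at x)" if "x \<in> A" for x
    unfolding R2_def using that R
    by (auto simp: A_def intro!: holomorphic_derivI[of _ "ball 0 r"] holomorphic_deriv)
  have d1: "deriv \<wp> x = - 2 / x ^ 3 + deriv wp_regular x" if "x \<in> A" for x
  proof -
    have "((\<lambda>x. 1 / x\<^sup>2) has_field_derivative - 2 / x ^ 3) (at x)"
      using inverse_square_has_derivative[of x 0] that by (simp add: A_def)
    from DERIV_add[OF this R_deriv(1)[OF that]] show ?thesis
      unfolding wp_eq[abs_def] by (rule DERIV_imp_deriv)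
  qed
  have d2: "deriv (deriv \<wp>) x = 6 / x ^ 4 + R2 x" if "x \<in> A" for x
  proof -
    have "((\<lambda>x. - 2 / x ^ 3) has_field_derivative 6 / x ^ 4) (at x)"
      using that by (auto intro!: derivative_eq_intros simp: A_def field_simps eval_nat_numeral)
    from DERIV_add[OF this R_deriv(2)[OF that]]
    have "(deriv \<wp> has_field_derivative 6 / x ^ 4 + R2 x) (at x)"
      by (rule has_field_derivative_transform_within_open[OF _ \<open>open A\<close> that]) (simp add: d1)
    then show ?thesis
      by (rule DERIV_imp_deriv)
  qed
  \<comment> \<open>\<open>f\<close> with the poles cancelled; it agrees with \<open>f\<close> on the punctured disc \<open>A\<close>\<close>
  define k where "k = (\<lambda>x. R2 x - 12 * h x - 6 * x ^ 4 * (h x)\<^sup>2)"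
  have f_eq: "k x = f x" if "x \<in> A" for x
  proof -
    have "x \<noteq> 0" "wp_regular x = x\<^sup>2 * h x"
      using that h(2) by (auto simp: A_def)
    then show ?thesis
      unfolding f_def k_def d2[OF that] wp_eq by (simp add: field_simps eval_nat_numeral)
  qed
  have "k holomorphic_on ball 0 r"
    unfolding k_def R2_def using R h by (intro holomorphic_intros holomorphic_deriv) auto
  then have "isCont k 0"
    using r(1) holomorphic_on_imp_continuous_on continuous_on_interior by fastforce
  then have "(k \<longlongrightarrow> k 0) (at 0)"
    by (simp add: isCont_def)
  moreover have "\<forall>\<^sub>F x in at 0. k x = f x"
    using eventually_at_in_open'[OF \<open>open A\<close>] f_eq r(1)
    by (auto simp: eventually_at A_def intro!: exI[of _ r])
  ultimately have lim0: "(f \<longlongrightarrow> k 0) (at 0)"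
    by (rule Lim_transform_eventually)
  have "f constant_on - \<Lambda>"
  proof (rule elliptic_without_poles_constant[OF hol lattice_sparse per])
    show "\<exists>L. (f \<longlongrightarrow> L) (at z)" if "z \<in> \<Lambda>" for z
      using periodic_tendsto[OF lattice_sparse per[OF _ that] lim0] by auto
  qed
  then obtain K where "\<And>x. x \<notin> \<Lambda> \<Longrightarrow> f x = K"
    by (auto simp: constant_on_def)
  then show ?thesis
    by (intro that[of K]) (auto simp: f_def algebra_simps)
qed

text \<open>
  The difference of the two sides has derivative \<open>2 \<wp>' (\<wp>'' - 6 \<wp>\<^sup>2 - K) = 0\<close>.
\<close>

lemma wp_first_order_ode:
  assumes K: "\<And>x. x \<notin> \<Lambda> \<Longrightarrow> deriv (deriv \<wp>) x = 6 * (\<wp> x)\<^sup>2 + K"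
  obtains B where "\<And>x. x \<notin> \<Lambda> \<Longrightarrow> (deriv \<wp> x)\<^sup>2 = 4 * \<wp> x ^ 3 + 2 * K * \<wp> x + B"
proof -
  define f where "f = (\<lambda>x. (deriv \<wp> x)\<^sup>2 - 4 * \<wp> x ^ 3 - 2 * K * \<wp> x)"
  have deriv: "(f has_field_derivative 0) (at x)" if "x \<notin> \<Lambda>" for x
    unfolding f_def
    by (rule derivative_eq_intros wp_DERIV[OF that] wp_DERIV2[OF that] refl)+
      (simp add: K[OF that] algebra_simps power2_eq_square)
  have "f constant_on - \<Lambda>"
    by (rule DERIV_zero_connected_constant_on[OF connected_Compl_lattice
          open_Compl_lattice(1) finite.emptyI])
      (use deriv in \<open>auto intro!: continuous_at_imp_continuous_on intro: DERIV_isCont\<close>)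
  then obtain B where "\<And>x. x \<notin> \<Lambda> \<Longrightarrow> f x = B"
    by (auto simp: constant_on_def)
  then show ?thesis
    by (intro that[of B]) (auto simp: f_def algebra_simps)
qed

end

section \<open>The addition formula\<close>

lemma tendsto_holomorphic_at_0:
  fixes k :: "complex \<Rightarrow> complex"
  assumes "k holomorphic_on ball 0 r" "r > 0"
  shows "(k \<longlongrightarrow> k 0) (at 0)"
proof -
  have "(k has_field_derivative deriv k 0) (at 0)"
    using assms by (intro holomorphic_derivI[OF _ open_ball]) auto
  then show ?thesis
    using DERIV_isCont isCont_def by blast
qed

text \<open>
  Divided differences of the cubic vanish at distinct roots, which determines its coefficients
  without factorizing it.
\<close>

lemma depressed_cubic_from_roots:
  fixes e1 e2 e3 K B :: complex
  assumes "4 * e1 ^ 3 + 2 * K * e1 + B = 0" "4 * e2 ^ 3 + 2 * K * e2 + B = 0"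
    "4 * e3 ^ 3 + 2 * K * e3 + B = 0" "e1 \<noteq> e2" "e1 \<noteq> e3" "e2 \<noteq> e3"
  shows "e1 + e2 + e3 = 0" "K = 2 * (e1 * e2 + e2 * e3 + e3 * e1)" "B = - 4 * e1 * e2 * e3"
proof -
  have "(e1 - e2) * (2 * (e1\<^sup>2 + e1 * e2 + e2\<^sup>2) + K) = 0"
    using assms(1,2) by algebra
  then have 12: "2 * (e1\<^sup>2 + e1 * e2 + e2\<^sup>2) + K = 0"
    using assms(4) by simp
  have "(e1 - e3) * (2 * (e1\<^sup>2 + e1 * e3 + e3\<^sup>2) + K) = 0"
    using assms(1,3) by algebra
  then have 13: "2 * (e1\<^sup>2 + e1 * e3 + e3\<^sup>2) + K = 0"
    using assms(5) by simp
  have "(e2 - e3) * (e1 + e2 + e3) = 0"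
    using 12 13 by algebra
  then show sum: "e1 + e2 + e3 = 0"
    using assms(6) by simp
  show K: "K = 2 * (e1 * e2 + e2 * e3 + e3 * e1)"
    using sum 12 by algebra
  show "B = - 4 * e1 * e2 * e3"
    using sum K assms(1) by algebra
qed

context period_pair
begin

lemma deriv2_wp_even:
  assumes "x \<notin> \<Lambda>"
  shows "deriv (deriv \<wp>) (- x) = deriv (deriv \<wp>) x"
proof -
  obtain K where "\<And>x. x \<notin> \<Lambda> \<Longrightarrow> deriv (deriv \<wp>) x = 6 * (\<wp> x)\<^sup>2 + K"
    using wp_second_order_ode by blast
  with assms show ?thesis
    by (simp add: wp_even)
qed

text \<open>
  Here \<open>\<alpha> \<equiv> - \<alpha>\<close> modulo periods, while \<open>\<wp>'\<close> is odd.
\<close>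

lemma deriv_wp_half_period:
  assumes "\<alpha> \<notin> \<Lambda>" "2 * \<alpha> \<in> \<Lambda>"
  shows "deriv \<wp> \<alpha> = 0"
proof -
  have "deriv \<wp> (- \<alpha> + 2 * \<alpha>) = deriv \<wp> (- \<alpha>)"
    using assms by (intro deriv_wp_periodic) auto
  then have "deriv \<wp> \<alpha> = - deriv \<wp> \<alpha>"
    using deriv_wp_odd[OF assms(1)] by simp
  then show ?thesis
    by (simp only: eq_neg_iff_add_eq_0 mult_2[symmetric]) simp
qed

text \<open>
  The double pole of the first factor meets a zero of at least the same order of the second one.
\<close>

lemma wp_double_pole_times_zero:
  assumes "z \<notin> \<Lambda>"
  shows "((\<lambda>x. \<wp> (x - z) * (\<wp> x - \<wp> z)\<^sup>2) \<longlongrightarrow> (deriv \<wp> z)\<^sup>2) (at z)"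
proof -
  have "((\<lambda>x. (\<wp> x - \<wp> z) / (x - z)) \<longlongrightarrow> deriv \<wp> z) (at z)"
    using wp_DERIV[OF assms] by (simp add: has_field_derivative_iff)
  moreover have "isCont wp_regular 0"
    using wp_regular_has_derivative[of 0] DERIV_isCont by blast
  then have "((\<lambda>x. wp_regular (x - z)) \<longlongrightarrow> wp_regular 0) (at z)"
    by (intro isCont_tendsto_compose[of _ wp_regular]) (auto intro!: tendsto_eq_intros)
  ultimately have "((\<lambda>x. ((\<wp> x - \<wp> z) / (x - z))\<^sup>2 * (1 + (x - z)\<^sup>2 * wp_regular (x - z)))
      \<longlongrightarrow> (deriv \<wp> z)\<^sup>2 * (1 + (z - z)\<^sup>2 * wp_regular 0)) (at z)"
    by (intro tendsto_intros)
  then have "((\<lambda>x. ((\<wp> x - \<wp> z) / (x - z))\<^sup>2 * (1 + (x - z)\<^sup>2 * wp_regular (x - z)))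
      \<longlongrightarrow> (deriv \<wp> z)\<^sup>2) (at z)"
    by simp
  moreover have "\<forall>\<^sub>F x in at z. ((\<wp> x - \<wp> z) / (x - z))\<^sup>2 * (1 + (x - z)\<^sup>2 * wp_regular (x - z))
      = \<wp> (x - z) * (\<wp> x - \<wp> z)\<^sup>2"
  proof (rule eventually_mono[OF eventually_neq_at_within])
    fix x assume "x \<noteq> z"
    then have "\<wp> (x - z) = (1 + (x - z)\<^sup>2 * wp_regular (x - z)) / (x - z)\<^sup>2"
      unfolding wp_eq by (simp add: add_divide_distrib)
    then show "((\<wp> x - \<wp> z) / (x - z))\<^sup>2 * (1 + (x - z)\<^sup>2 * wp_regular (x - z))
      = \<wp> (x - z) * (\<wp> x - \<wp> z)\<^sup>2"
      by (simp add: power_divide)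
  qed
  ultimately show ?thesis
    by (rule Lim_transform_eventually)
qed

lemma wp_double_pole_times_zero_shifted:
  assumes "z \<notin> \<Lambda>" "z - a \<in> \<Lambda>"
  shows "((\<lambda>x. \<wp> (x - a) * (\<wp> x - \<wp> a)\<^sup>2) \<longlongrightarrow> (deriv \<wp> z)\<^sup>2) (at z)"
proof -
  have "a \<notin> \<Lambda>"
    using assms lattice_add[of "z - a" a] by auto
  then have "\<wp> a = \<wp> z"
    using wp_periodic[OF assms(2), of a] by simp
  have "\<forall>\<^sub>F x in at z. x - z \<notin> \<Lambda>"
    using eventually_not_lattice[of "- z" z] by simp
  then have "\<forall>\<^sub>F x in at z. \<wp> (x - z) * (\<wp> x - \<wp> z)\<^sup>2 = \<wp> (x - a) * (\<wp> x - \<wp> a)\<^sup>2"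
  proof eventually_elim
    case (elim x)
    then show ?case
      using wp_periodic[OF assms(2) elim] \<open>\<wp> a = \<wp> z\<close> by simp
  qed
  with wp_double_pole_times_zero[OF assms(1)] show ?thesis
    by (rule Lim_transform_eventually)
qed

lemma wp_isCont: "z \<notin> \<Lambda> \<Longrightarrow> isCont \<wp> z"
  using wp_DERIV DERIV_isCont by blast

lemma wp_tendsto_shift: "z + a \<notin> \<Lambda> \<Longrightarrow> ((\<lambda>x. \<wp> (x + a)) \<longlongrightarrow> \<wp> (z + a)) (at z)"
  by (intro isCont_tendsto_compose[OF wp_isCont]) (auto intro!: tendsto_eq_intros)

lemma wp_shift_holomorphic: "(\<lambda>x. \<wp> (x + a)) holomorphic_on {x. x + a \<notin> \<Lambda>}"
proof -
  have "(\<wp> \<circ> (\<lambda>x. x + a)) holomorphic_on {x. x + a \<notin> \<Lambda>}"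
    by (rule holomorphic_on_compose_gen[OF _ wp_holomorphic]) (auto intro!: holomorphic_intros)
  then show ?thesis
    by (simp add: o_def)
qed

text \<open>
  The Taylor expansion of an even function up to the fourth order; this is the precision needed
  below, where the sum is multiplied by a function with a pole of order four at the origin.
\<close>

lemma wp_sum_near_0:
  assumes "\<delta> \<notin> \<Lambda>"
  shows "\<exists>r s. r > 0 \<and> s holomorphic_on ball 0 r \<and>
    (\<forall>x\<in>ball 0 r. \<wp> (x + \<delta>) + \<wp> (x - \<delta>)
       = 2 * \<wp> \<delta> + deriv (deriv \<wp>) \<delta> * x\<^sup>2 + s x * x ^ 4)"
proof -
  define S where "S = {x. x + \<delta> \<notin> \<Lambda>} \<inter> {x. x + (- \<delta>) \<notin> \<Lambda>}"
  have "open S"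
    unfolding S_def by (intro open_Int open_translate_complement)
  moreover have "0 \<in> S"
    using assms by (simp add: S_def)
  ultimately obtain r where r: "r > 0" "ball 0 r \<subseteq> S"
    by (meson open_contains_ball)
  define g where "g = (\<lambda>x. \<wp> (x + \<delta>) + \<wp> (x + (- \<delta>)))"
  have "g holomorphic_on ball 0 r"
    unfolding g_def
    by (intro holomorphic_on_add holomorphic_on_subset[OF wp_shift_holomorphic])
      (use r in \<open>auto simp: S_def\<close>)
  moreover have even: "g (- x) = g x" for x
    using wp_even[of "x - \<delta>"] wp_even[of "x + \<delta>"] by (simp add: g_def)
  ultimately obtain s1 where s1: "s1 holomorphic_on ball 0 r"
    "\<And>x. x \<in> ball 0 r \<Longrightarrow> g x = g 0 + x\<^sup>2 * s1 x"
    "\<And>x. x \<in> ball 0 r \<Longrightarrow> s1 (- x) = s1 x"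
    using even_holomorphic_factor_square[OF _ r(1), of g] by blast
  obtain s2 where s2: "s2 holomorphic_on ball 0 r"
    "\<And>x. x \<in> ball 0 r \<Longrightarrow> s1 x = s1 0 + x\<^sup>2 * s2 x"
    using even_holomorphic_factor_square[OF s1(1) r(1)] s1(3) by blast
  have g0: "g 0 = 2 * \<wp> \<delta>"
    by (simp add: g_def wp_even)
  have "s1 0 = deriv (deriv \<wp>) \<delta>"
  proof -
    define g1 where "g1 = (\<lambda>x. deriv \<wp> (x + \<delta>) + deriv \<wp> (x + (- \<delta>)))"
    have s1_deriv: "(s1 has_field_derivative deriv s1 x) (at x)"
      "(deriv s1 has_field_derivative deriv (deriv s1) x) (at x)" if "x \<in> ball 0 r" for x
      using holomorphic_derivI[OF s1(1) open_ball that]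
        holomorphic_derivI[OF holomorphic_deriv[OF s1(1) open_ball] open_ball that] .
    have g1: "g1 x = 2 * x * s1 x + x\<^sup>2 * deriv s1 x" if x: "x \<in> ball 0 r" for x
    proof -
      have "x + \<delta> \<notin> \<Lambda>" "x + (- \<delta>) \<notin> \<Lambda>"
        using x r by (auto simp: S_def)
      then have "(g has_field_derivative g1 x) (at x)"
        unfolding g_def g1_def by (intro DERIV_add DERIV_shift[of \<wp>, THEN iffD1] wp_DERIV)
      moreover have "((\<lambda>x. g 0 + x\<^sup>2 * s1 x) has_field_derivative 2 * x * s1 x + x\<^sup>2 * deriv s1 x) (at x)"
        by (auto intro!: derivative_eq_intros s1_deriv x)
      then have "(g has_field_derivative 2 * x * s1 x + x\<^sup>2 * deriv s1 x) (at x)"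
        by (rule has_field_derivative_transform_within_open[OF _ open_ball x]) (simp add: s1(2))
      ultimately show ?thesis
        by (rule DERIV_unique)
    qed
    have 0: "0 \<in> ball (0::complex) r" using r by simp
    have "((\<lambda>x. 2 * x * s1 x + x\<^sup>2 * deriv s1 x) has_field_derivative 2 * s1 0) (at 0)"
      by (auto intro!: derivative_eq_intros s1_deriv 0)
    then have "(g1 has_field_derivative 2 * s1 0) (at 0)"
      by (rule has_field_derivative_transform_within_open[OF _ open_ball 0]) (simp add: g1)
    moreover have "(g1 has_field_derivative deriv (deriv \<wp>) (0 + \<delta>) + deriv (deriv \<wp>) (0 + (- \<delta>))) (at 0)"
      unfolding g1_def using assms
      by (intro DERIV_add DERIV_shift[of "deriv \<wp>", THEN iffD1] wp_DERIV2) auto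
    ultimately have "2 * s1 0 = deriv (deriv \<wp>) (0 + \<delta>) + deriv (deriv \<wp>) (0 + (- \<delta>))"
      by (rule DERIV_unique)
    then show ?thesis
      using deriv2_wp_even[OF assms] by simp
  qed
  then have "\<wp> (x + \<delta>) + \<wp> (x - \<delta>)
       = 2 * \<wp> \<delta> + deriv (deriv \<wp>) \<delta> * x\<^sup>2 + s2 x * x ^ 4" if "x \<in> ball 0 r" for x
    using s1(2)[OF that] s2(2)[OF that] g0
    by (simp add: g_def algebra_simps power2_eq_square eval_nat_numeral)
  with r(1) s2(1) show ?thesis
    by blast
qed

text \<open>
  The usual formula divides by \<open>(\<wp> x - \<wp> \<delta>)\<^sup>2\<close>.  Cleared of denominators it also holds where
  \<open>\<wp> x = \<wp> \<delta>\<close>, which is how it yields \<open>wp_eq_imp_congruent\<close>.  For the proof, all terms that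
  depend on \<open>x\<close> are collected in \<open>f\<close>: the poles of \<open>\<wp> (x \<plusminus> \<delta>)\<close> are cancelled by zeros of
  \<open>(\<wp> x - \<wp> \<delta>)\<^sup>2\<close>, and the pole of order four at the origin by the expansion of the sum, so \<open>f\<close> is
  constant.  The constant is the limit of \<open>f\<close> at \<open>\<delta>\<close>.
\<close>

lemma wp_addition_formula:
  assumes "\<delta> \<notin> \<Lambda>" "x \<notin> \<Lambda>" "x + \<delta> \<notin> \<Lambda>" "x - \<delta> \<notin> \<Lambda>"
  shows "(\<wp> (x + \<delta>) + \<wp> (x - \<delta>)) * (\<wp> x - \<wp> \<delta>)\<^sup>2
    = 2 * \<wp> \<delta> * (\<wp> x - \<wp> \<delta>)\<^sup>2 + deriv (deriv \<wp>) \<delta> * (\<wp> x - \<wp> \<delta>) + (deriv \<wp> \<delta>)\<^sup>2"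
proof -
  define \<kappa> where "\<kappa> = deriv (deriv \<wp>) \<delta>"
  define D where "D = {x. x + 0 \<in> \<Lambda>} \<union> {x. x + \<delta> \<in> \<Lambda>} \<union> {x. x + (- \<delta>) \<in> \<Lambda>}"
  have notD: "x \<notin> D \<longleftrightarrow> x \<notin> \<Lambda> \<and> x + \<delta> \<notin> \<Lambda> \<and> x - \<delta> \<notin> \<Lambda>" for x
    by (simp add: D_def)
  have D: "D sparse_in UNIV"
    unfolding D_def by (intro sparse_in_union' lattice_translate_sparse)
  define p where "p = (\<lambda>x. \<wp> x - \<wp> \<delta>)"
  define f where "f = (\<lambda>x. \<wp> (x + \<delta>) * (p x)\<^sup>2 + \<wp> (x + (- \<delta>)) * (p x)\<^sup>2 - 2 * \<wp> \<delta> * (p x)\<^sup>2 - \<kappa> * p x)"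
  have hol: "f holomorphic_on - D"
    unfolding f_def p_def
    by (intro holomorphic_intros holomorphic_on_subset[OF wp_shift_holomorphic]
          holomorphic_on_subset[OF wp_holomorphic]) (auto simp: D_def)
  have per: "f (x + w) = f x" if "x \<notin> D" "w \<in> \<Lambda>" for x w
  proof -
    have "\<wp> (x + w) = \<wp> x"
      using that by (intro wp_periodic) (auto simp: notD)
    moreover have "\<wp> (x + w + \<delta>) = \<wp> (x + \<delta>)"
      using that wp_periodic[of w "x + \<delta>"] by (simp add: notD add_ac)
    moreover have "\<wp> (x + w + (- \<delta>)) = \<wp> (x + (- \<delta>))"
      using that wp_periodic[of w "x - \<delta>"] by (simp add: notD algebra_simps)
    ultimately show ?thesis
      by (simp add: f_def p_def)
  qed
  have p_lim: "(p \<longlongrightarrow> p z) (at z)" if "z \<notin> \<Lambda>" for z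
    unfolding p_def using wp_isCont[OF that] by (intro tendsto_intros) (simp add: isCont_def)
  have term_lim: "((\<lambda>x. \<wp> (x + a) * (p x)\<^sup>2) \<longlongrightarrow> (if z + a \<in> \<Lambda> then (deriv \<wp> z)\<^sup>2 else \<wp> (z + a) * (p z)\<^sup>2)) (at z)"
    if z: "z \<notin> \<Lambda>" and a: "a = \<delta> \<or> a = - \<delta>" for z a
  proof (cases "z + a \<in> \<Lambda>")
    case True
    have "\<wp> (- a) = \<wp> \<delta>"
      using a by (auto simp: wp_even)
    then show ?thesis
      using True wp_double_pole_times_zero_shifted[OF z, of "- a"] by (simp add: p_def)
  next
    case False
    then show ?thesis
      by (auto intro!: tendsto_intros p_lim z wp_tendsto_shift)
  qed
  \<comment> \<open>at \<open>z = \<delta>\<close> this also covers the case that \<open>2 \<delta>\<close> is a period and both terms have a pole\<close>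
  have f_lim: "(f \<longlongrightarrow> (if z + \<delta> \<in> \<Lambda> then (deriv \<wp> z)\<^sup>2 else \<wp> (z + \<delta>) * (p z)\<^sup>2)
      + (if z + (- \<delta>) \<in> \<Lambda> then (deriv \<wp> z)\<^sup>2 else \<wp> (z + (- \<delta>)) * (p z)\<^sup>2)
      - 2 * \<wp> \<delta> * (p z)\<^sup>2 - \<kappa> * p z) (at z)" if z: "z \<notin> \<Lambda>" for z
    unfolding f_def by (intro tendsto_intros term_lim p_lim z) auto
  have f_lim_0: "\<exists>L. (f \<longlongrightarrow> L) (at 0)"
  proof -
    obtain r1 s where r1: "r1 > 0" and s: "s holomorphic_on ball 0 r1"
      "\<And>x. x \<in> ball 0 r1 \<Longrightarrow> \<wp> (x + \<delta>) + \<wp> (x - \<delta>) = 2 * \<wp> \<delta> + \<kappa> * x\<^sup>2 + s x * x ^ 4"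
      unfolding \<kappa>_def using wp_sum_near_0[OF assms(1)] by blast
    obtain r2 h where r2: "r2 > 0" and h: "h holomorphic_on ball 0 r2"
      "\<And>x. x \<in> ball 0 r2 \<Longrightarrow> wp_regular x = x\<^sup>2 * h x"
      using wp_near_0 by blast
    define r where "r = min r1 r2"
    have r: "r > 0" using r1 r2 by (simp add: r_def)
    define m where "m = (\<lambda>x. x\<^sup>2 * h x - \<wp> \<delta>)"
    \<comment> \<open>\<open>x\<^sup>2 * p x = 1 + x\<^sup>2 * m x\<close>, and \<open>k\<close> is \<open>f\<close> rewritten in terms of \<open>x\<^sup>2 * p x\<close>\<close>
    define k where "k = (\<lambda>x. (1 + x\<^sup>2 * m x) * (s x * (1 + x\<^sup>2 * m x) + \<kappa> * m x))"
    have "k holomorphic_on ball 0 r"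
      unfolding k_def m_def
      by (intro holomorphic_intros holomorphic_on_subset[OF s(1)] holomorphic_on_subset[OF h(1)])
        (auto simp: r_def)
    then have "(k \<longlongrightarrow> k 0) (at 0)"
      using r by (rule tendsto_holomorphic_at_0)
    moreover have "\<forall>\<^sub>F x in at 0. k x = f x"
    proof -
      have "k x = f x" if "x \<in> ball 0 r" "x \<noteq> 0" for x
      proof -
        have in12: "x \<in> ball 0 r1" "x \<in> ball 0 r2"
          using that by (auto simp: r_def)
        have u: "x\<^sup>2 * p x = 1 + x\<^sup>2 * m x"
          unfolding p_def m_def wp_eq[of x] h(2)[OF in12(2)] using that(2) by (simp add: field_simps)
        then have u': "x\<^sup>2 * p x - 1 = x\<^sup>2 * m x"
          by simp
        have "f x = (\<wp> (x + \<delta>) + \<wp> (x - \<delta>) - 2 * \<wp> \<delta>) * (p x)\<^sup>2 - \<kappa> * p x"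
          unfolding f_def by (simp add: algebra_simps)
        also have "\<dots> = \<kappa> * p x * (x\<^sup>2 * p x - 1) + s x * (x\<^sup>2 * p x)\<^sup>2"
          unfolding s(2)[OF in12(1)] by (simp add: algebra_simps power2_eq_square eval_nat_numeral)
        also have "\<dots> = \<kappa> * m x * (x\<^sup>2 * p x) + s x * (x\<^sup>2 * p x)\<^sup>2"
          unfolding u' by (simp add: mult_ac)
        finally show ?thesis
          unfolding u k_def by (simp add: algebra_simps power2_eq_square)
      qed
      then show ?thesis
        using r by (auto simp: eventually_at intro!: exI[of _ r])
    qed
    ultimately show ?thesis
      using Lim_transform_eventually by blast
  qed
  have "f constant_on - D"
  proof (rule elliptic_without_poles_constant[OF hol D per])
    fix z
    show "\<exists>L. (f \<longlongrightarrow> L) (at z)"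
    proof (cases "z \<in> \<Lambda>")
      case True
      obtain L where "(f \<longlongrightarrow> L) (at 0)"
        using f_lim_0 by blast
      from periodic_tendsto[OF D per[OF _ True] this] show ?thesis
        by auto
    next
      case False
      from f_lim[OF this] show ?thesis by blast
    qed
  qed
  then obtain c where c: "\<And>x. x \<notin> D \<Longrightarrow> f x = c"
    by (auto simp: constant_on_def)
  have "\<forall>\<^sub>F x in at \<delta>. x \<notin> D"
    using D by (simp add: sparse_in_eventually_iff)
  then have "\<forall>\<^sub>F x in at \<delta>. f x = c"
    by eventually_elim (rule c)
  then have "(f \<longlongrightarrow> c) (at \<delta>)"
    by (rule tendsto_eventually)
  moreover have "(f \<longlongrightarrow> (deriv \<wp> \<delta>)\<^sup>2) (at \<delta>)"
  proof (cases "\<delta> + \<delta> \<in> \<Lambda>")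
    case True
    then have "deriv \<wp> \<delta> = 0"
      by (intro deriv_wp_half_period assms) (simp only: mult_2)
    with True show ?thesis
      using f_lim[OF assms(1)] by (simp add: p_def)
  next
    case False
    then show ?thesis
      using f_lim[OF assms(1)] by (simp add: p_def)
  qed
  ultimately have "c = (deriv \<wp> \<delta>)\<^sup>2"
    by (rule tendsto_unique[OF at_neq_bot])
  moreover have "f x = c"
    using assms by (intro c) (simp add: notD)
  ultimately show ?thesis
    by (simp add: f_def p_def \<kappa>_def algebra_simps)
qed

text \<open>
  Otherwise the addition formula would hold at \<open>x\<close> and reduce to \<open>0 = (\<wp>' \<delta>)\<^sup>2\<close>.
\<close>

lemma wp_eq_imp_congruent:
  assumes "\<delta> \<notin> \<Lambda>" "x \<notin> \<Lambda>" "\<wp> x = \<wp> \<delta>" "deriv \<wp> \<delta> \<noteq> 0"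
  shows "x + \<delta> \<in> \<Lambda> \<or> x - \<delta> \<in> \<Lambda>"
  using wp_addition_formula[OF assms(1,2)] assms(3,4) by auto

text \<open>
  At a lattice point \<open>\<wp>\<close> has a pole, which also shows that \<open>\<wp>\<close> is not the constant \<open>e\<close>; at all
  other points the zeros of \<open>\<wp> - e\<close> are therefore isolated.
\<close>

lemma eventually_wp_neq: "\<forall>\<^sub>F x in at z. \<wp> x \<noteq> e"
proof -
  obtain r h where r: "r > 0" "\<And>x. x \<in> ball 0 r - {0} \<Longrightarrow> x \<notin> \<Lambda>"
    and h: "wp_regular holomorphic_on ball 0 r"
    using wp_near_0 by blast
  have "(wp_regular \<longlongrightarrow> wp_regular 0) (at 0)"
    by (rule tendsto_holomorphic_at_0[OF h r(1)])
  then have "((\<lambda>x. 1 + x\<^sup>2 * (wp_regular x - e)) \<longlongrightarrow> 1 + 0\<^sup>2 * (wp_regular 0 - e)) (at 0)"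
    by (intro tendsto_intros)
  then have "\<forall>\<^sub>F x in at 0. 1 + x\<^sup>2 * (wp_regular x - e) \<noteq> 0"
    by (intro tendsto_imp_eventually_ne) auto
  then have near_0: "\<forall>\<^sub>F x in at 0. \<wp> x \<noteq> e"
    using eventually_neq_at_within[of 0 0 UNIV]
    by eventually_elim (auto simp: wp_eq field_simps)
  show ?thesis
  proof (cases "z \<in> \<Lambda>")
    case True
    have "\<forall>\<^sub>F x in at 0. \<wp> (x + z) \<noteq> e"
      using near_0 eventually_not_lattice[of 0 0]
      by eventually_elim (simp add: wp_periodic[OF True])
    then show ?thesis
      by (simp add: eventually_at_to_0[of _ z])
  next
    case False
    obtain x0 where x0: "\<wp> x0 \<noteq> e" "x0 \<notin> \<Lambda>"
      using eventually_happens[OF eventually_conj[OF near_0 eventually_not_lattice[of 0 0]]] by auto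
    show ?thesis
    proof (cases "\<wp> z = e")
      case True
      obtain d where "d > 0" "\<And>x. x \<in> ball z d - {z} \<Longrightarrow> \<wp> x - e \<noteq> 0"
      proof (rule isolated_zeros[of "\<lambda>x. \<wp> x - e" "- \<Lambda>" z x0])
        show "(\<lambda>x. \<wp> x - e) holomorphic_on - \<Lambda>"
          by (intro holomorphic_intros wp_holomorphic)
      qed (use True False x0 open_Compl_lattice connected_Compl_lattice in auto)
      then show ?thesis
        by (auto simp: eventually_at dist_commute intro!: exI[of _ d])
    next
      case neq: False
      have "(\<wp> \<longlongrightarrow> \<wp> z) (at z)"
        using wp_isCont[OF False] by (simp add: isCont_def)
      then show ?thesis
        using neq by (rule tendsto_imp_eventually_ne)
    qed
  qed
qed

text \<open>
  For \<open>\<delta> = \<alpha>\<close> the two terms on the left of the addition formula agree and \<open>\<wp>' \<alpha> = 0\<close>, so one factor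
  \<open>\<wp> x - \<wp> \<alpha>\<close> cancels and \<open>2 (\<wp> (x - \<alpha>) - \<wp> \<alpha>) (\<wp> x - \<wp> \<alpha>)\<close> is a constant.  If \<open>\<wp> \<beta> = \<wp> \<alpha>\<close>, this
  constant is \<open>0\<close>, although neither factor vanishes at the points near \<open>\<beta>\<close>.
\<close>

lemma wp_half_periods_distinct:
  assumes "\<alpha> \<notin> \<Lambda>" "2 * \<alpha> \<in> \<Lambda>" "\<beta> \<notin> \<Lambda>" "\<beta> - \<alpha> \<notin> \<Lambda>"
  shows "\<wp> \<beta> \<noteq> \<wp> \<alpha>"
proof
  assume eq: "\<wp> \<beta> = \<wp> \<alpha>"
  define \<kappa> where "\<kappa> = deriv (deriv \<wp>) \<alpha>"
  define F where "F = (\<lambda>x. 2 * (\<wp> (x + (- \<alpha>)) - \<wp> \<alpha>) * (\<wp> x - \<wp> \<alpha>))"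
  \<comment> \<open>all points close to \<open>\<beta>\<close>, but not \<open>\<beta>\<close> itself, are generic\<close>
  have near: "\<forall>\<^sub>F x in at \<beta>. x \<notin> \<Lambda> \<and> x + (- \<alpha>) \<notin> \<Lambda> \<and> \<wp> x \<noteq> \<wp> \<alpha> \<and> \<wp> (x + (- \<alpha>)) \<noteq> \<wp> \<alpha>"
  proof -
    have "\<forall>\<^sub>F x in at \<beta>. \<wp> (x + (- \<alpha>)) \<noteq> \<wp> \<alpha>"
      using eventually_wp_neq[of "\<wp> \<alpha>" "\<beta> - \<alpha>"]
      by (simp add: eventually_at_to_0[of _ \<beta>] eventually_at_to_0[of _ "\<beta> - \<alpha>"] add_diff_eq)
    then show ?thesis
      using eventually_not_lattice[of 0 \<beta>] eventually_not_lattice[of "- \<alpha>" \<beta>]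
        eventually_wp_neq[of "\<wp> \<alpha>" \<beta>]
      by eventually_elim simp
  qed
  have F_eq: "\<forall>\<^sub>F x in at \<beta>. F x = \<kappa>"
    using near
  proof eventually_elim
    case (elim x)
    then have x: "x \<notin> \<Lambda>" "x - \<alpha> \<notin> \<Lambda>" by auto
    have "x - \<alpha> + 2 * \<alpha> \<notin> \<Lambda>"
      using x(2) assms(2) by (subst lattice_add_iff) auto
    then have x': "x + \<alpha> \<notin> \<Lambda>"
      by (simp add: algebra_simps)
    have "\<wp> (x - \<alpha> + 2 * \<alpha>) = \<wp> (x - \<alpha>)"
      by (rule wp_periodic[OF assms(2) x(2)])
    then have "\<wp> (x + \<alpha>) = \<wp> (x - \<alpha>)"
      by (simp add: algebra_simps)
    then have "(\<wp> x - \<wp> \<alpha>) * (F x - \<kappa>) = 0"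
      using wp_addition_formula[OF assms(1) x(1) x' x(2)] deriv_wp_half_period[OF assms(1,2)]
      by (simp add: F_def \<kappa>_def algebra_simps power2_eq_square)
    then show ?case
      using elim by simp
  qed
  have "(F \<longlongrightarrow> 2 * (\<wp> (\<beta> + (- \<alpha>)) - \<wp> \<alpha>) * (\<wp> \<beta> - \<wp> \<alpha>)) (at \<beta>)"
    unfolding F_def using assms wp_tendsto_shift[of \<beta> 0]
    by (intro tendsto_intros wp_tendsto_shift) auto
  moreover have "(F \<longlongrightarrow> \<kappa>) (at \<beta>)"
    using F_eq by (rule tendsto_eventually)
  ultimately have "2 * (\<wp> (\<beta> + (- \<alpha>)) - \<wp> \<alpha>) * (\<wp> \<beta> - \<wp> \<alpha>) = \<kappa>"
    by (rule tendsto_unique[OF at_neq_bot])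
  then have "\<kappa> = 0"
    using eq by simp
  have "\<forall>\<^sub>F x in at \<beta>. False"
    by (rule eventually_mono[OF eventually_conj[OF near F_eq]])
      (use \<open>\<kappa> = 0\<close> in \<open>auto simp: F_def\<close>)
  then show False
    by (simp add: eventually_False)
qed

lemma half_lattice_iff: "of_int m * \<omega>1 + of_int n * \<omega>3 \<in> \<Lambda> \<longleftrightarrow> even m \<and> even n"
proof
  assume "of_int m * \<omega>1 + of_int n * \<omega>3 \<in> \<Lambda>"
  then obtain m' n' where "of_int m * \<omega>1 + of_int n * \<omega>3 = of_int m' * (2 * \<omega>1) + of_int n' * (2 * \<omega>3)"
    by (auto simp: lattice_iff)
  then have "of_real (of_int (m - 2 * m')) * \<omega>1 + of_real (of_int (n - 2 * n')) * \<omega>3 = 0"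
    by (simp add: algebra_simps)
  from periods_indep[OF this] have "m - 2 * m' = 0 \<and> n - 2 * n' = 0"
    by (simp only: of_int_eq_0_iff)
  then show "even m \<and> even n"
    by presburger
next
  assume "even m \<and> even n"
  then obtain m' n' where "m = 2 * m'" "n = 2 * n'"
    by (auto elim!: evenE)
  then have "of_int m * \<omega>1 + of_int n * \<omega>3 = of_int m' * (2 * \<omega>1) + of_int n' * (2 * \<omega>3)"
    by simp
  then show "of_int m * \<omega>1 + of_int n * \<omega>3 \<in> \<Lambda>"
    unfolding lattice_iff by blast
qed

abbreviation g2 where "g2 \<equiv> wp_g2 \<omega>1 \<omega>3"
abbreviation g3 where "g3 \<equiv> wp_g3 \<omega>1 \<omega>3"
abbreviation e where "e \<equiv> wp_e \<omega>1 \<omega>3"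

lemma half_period_props:
  assumes "i \<in> {1..3}"
  shows "half_period \<omega>1 \<omega>3 i \<notin> \<Lambda>" "2 * half_period \<omega>1 \<omega>3 i \<in> \<Lambda>"
    "j \<in> {1..3} \<Longrightarrow> j \<noteq> i \<Longrightarrow> half_period \<omega>1 \<omega>3 j - half_period \<omega>1 \<omega>3 i \<notin> \<Lambda>"
proof -
  define M N :: "nat \<Rightarrow> int"
    where "M = (\<lambda>i. if i = 1 then 1 else if i = 2 then -1 else 0)"
      and "N = (\<lambda>i. if i = 2 then -1 else if i = 3 then 1 else 0)"
  have hp: "half_period \<omega>1 \<omega>3 i = of_int (M i) * \<omega>1 + of_int (N i) * \<omega>3" for i
    by (simp add: half_period_def M_def N_def)
  have cases: "k = 1 \<or> k = 2 \<or> k = 3" if "k \<in> {1..3}" for k :: nat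
    using that by auto
  show "half_period \<omega>1 \<omega>3 i \<notin> \<Lambda>"
    unfolding hp half_lattice_iff using cases[OF assms] by (auto simp: M_def N_def)
  have "2 * half_period \<omega>1 \<omega>3 i = of_int (2 * M i) * \<omega>1 + of_int (2 * N i) * \<omega>3"
    unfolding hp by (simp add: algebra_simps)
  then show "2 * half_period \<omega>1 \<omega>3 i \<in> \<Lambda>"
    by (simp only: half_lattice_iff) simp
  assume j: "j \<in> {1..3}" "j \<noteq> i"
  have "half_period \<omega>1 \<omega>3 j - half_period \<omega>1 \<omega>3 i
      = of_int (M j - M i) * \<omega>1 + of_int (N j - N i) * \<omega>3"
    unfolding hp by (simp add: algebra_simps)
  then show "half_period \<omega>1 \<omega>3 j - half_period \<omega>1 \<omega>3 i \<notin> \<Lambda>"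
    using cases[OF assms] cases[OF j(1)] j(2)
    by (simp only: half_lattice_iff) (auto simp: M_def N_def)
qed

lemma weierstrass_equations:
  assumes "x \<notin> \<Lambda>"
  shows "deriv (deriv \<wp>) x = 6 * (\<wp> x)\<^sup>2 - g2 / 2"
    and "(deriv \<wp> x)\<^sup>2 = 4 * \<wp> x ^ 3 - g2 * \<wp> x - g3"
    and "(deriv \<wp> x)\<^sup>2 = 4 * (\<wp> x - e 1) * (\<wp> x - e 2) * (\<wp> x - e 3)"
proof -
  obtain K where K: "\<And>x. x \<notin> \<Lambda> \<Longrightarrow> deriv (deriv \<wp>) x = 6 * (\<wp> x)\<^sup>2 + K"
    using wp_second_order_ode by blast
  obtain B where B: "\<And>x. x \<notin> \<Lambda> \<Longrightarrow> (deriv \<wp> x)\<^sup>2 = 4 * \<wp> x ^ 3 + 2 * K * \<wp> x + B"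
    using wp_first_order_ode[OF K] by blast
  have root: "4 * e i ^ 3 + 2 * K * e i + B = 0" if "i \<in> {1..3}" for i
    using B[OF half_period_props(1)[OF that]]
      deriv_wp_half_period[OF half_period_props(1,2)[OF that]] by (simp add: wp_e_def)
  have neq: "e j \<noteq> e i" if "i \<in> {1..3}" "j \<in> {1..3}" "j \<noteq> i" for i j
    unfolding wp_e_def
    by (intro wp_half_periods_distinct half_period_props that)
  have sum: "e 1 + e 2 + e 3 = 0" and K_eq: "K = 2 * (e 1 * e 2 + e 2 * e 3 + e 3 * e 1)"
    and B_eq: "B = - 4 * e 1 * e 2 * e 3"
    using depressed_cubic_from_roots[OF root[of 1] root[of 2] root[of 3]] neq by auto
  have g: "K = - g2 / 2" "B = - g3"
    unfolding K_eq B_eq by (simp_all add: wp_g2_def wp_g3_def)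
  show "deriv (deriv \<wp>) x = 6 * (\<wp> x)\<^sup>2 - g2 / 2"
    using K[OF assms] g by simp
  show "(deriv \<wp> x)\<^sup>2 = 4 * \<wp> x ^ 3 - g2 * \<wp> x - g3"
    using B[OF assms] g by simp
  show "(deriv \<wp> x)\<^sup>2 = 4 * (\<wp> x - e 1) * (\<wp> x - e 2) * (\<wp> x - e 3)"
    using B[OF assms] K_eq B_eq sum by algebra
qed

end

section \<open>Solutions from a first integral\<close>

text \<open>
  The derivative is \<open>\<Xi> / 2\<close> times the left-hand side of the third-order equation.
\<close>

lemma first_integral_constant:
  fixes \<Xi> v :: "complex \<Rightarrow> complex"
  assumes "open A" "connected A" "\<Xi> holomorphic_on A" "v holomorphic_on A"
    and ode: "\<And>x. x \<in> A \<Longrightarrow>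
      deriv (deriv (deriv \<Xi>)) x - 4 * (v x - E) * deriv \<Xi> x - 2 * deriv v x * \<Xi> x = 0"
  shows "(\<lambda>x. (\<Xi> x)\<^sup>2 * (E - v x) + 1 / 2 * \<Xi> x * deriv (deriv \<Xi>) x - 1 / 4 * (deriv \<Xi> x)\<^sup>2)
    constant_on A" (is "?Q constant_on A")
proof (rule DERIV_zero_connected_constant_on[OF assms(2,1) finite.emptyI])
  have deriv: "(?Q has_field_derivative 0) (at x)" if x: "x \<in> A" for x
  proof -
    note d = holomorphic_derivI[OF assms(3,1) x]
      holomorphic_derivI[OF holomorphic_deriv[OF assms(3,1)] assms(1) x]
      holomorphic_derivI[OF holomorphic_deriv[OF holomorphic_deriv[OF assms(3,1)] assms(1)] assms(1) x]
      holomorphic_derivI[OF assms(4,1) x]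
    have "(?Q has_field_derivative 1 / 2 * \<Xi> x *
        (deriv (deriv (deriv \<Xi>)) x - 4 * (v x - E) * deriv \<Xi> x - 2 * deriv v x * \<Xi> x)) (at x)"
      by (rule derivative_eq_intros d refl)+ (simp add: algebra_simps power2_eq_square)
    then show ?thesis
      using ode[OF x] by simp
  qed
  then show "continuous_on A ?Q"
    by (intro continuous_at_imp_continuous_on) (auto intro: DERIV_isCont)
  from deriv show "\<forall>x\<in>A - {}. (?Q has_field_derivative 0) (at x)"
    by auto
qed

text \<open>
  The passage between a linear equation of second order for \<open>f\<close> and a Riccati equation for its
  logarithmic derivative \<open>u\<close>.
\<close>

lemma log_derivative_second_deriv:
  fixes f u :: "complex \<Rightarrow> complex"
  assumes "open U" "x \<in> U"
    and f: "\<And>x. x \<in> U \<Longrightarrow> (f has_field_derivative f x * u x) (at x)"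
    and u: "(u has_field_derivative u') (at x)"
  shows "deriv f x = f x * u x" "deriv (deriv f) x = f x * ((u x)\<^sup>2 + u')"
proof -
  have d: "deriv f y = f y * u y" if "y \<in> U" for y
    using f[OF that] by (rule DERIV_imp_deriv)
  show "deriv f x = f x * u x"
    by (rule d[OF assms(2)])
  have "((\<lambda>y. f y * u y) has_field_derivative f x * ((u x)\<^sup>2 + u')) (at x)"
    by (rule derivative_eq_intros f[OF assms(2)] u refl)+ (simp add: algebra_simps power2_eq_square)
  then have "(deriv f has_field_derivative f x * ((u x)\<^sup>2 + u')) (at x)"
    by (rule has_field_derivative_transform_within_open[OF _ assms(1,2)]) (simp add: d)
  then show "deriv (deriv f) x = f x * ((u x)\<^sup>2 + u')"
    by (rule DERIV_imp_deriv)
qed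

lemma square_root_log_derivative:
  fixes g f :: "complex \<Rightarrow> complex"
  assumes "open U" "x \<in> U" "g holomorphic_on U" "\<And>x. x \<in> U \<Longrightarrow> (g x)\<^sup>2 = f x"
    and "(f has_field_derivative f') (at x)" "f x \<noteq> 0"
  shows "(g has_field_derivative g x * (f' / (2 * f x))) (at x)"
proof -
  have g: "(g has_field_derivative deriv g x) (at x)"
    using assms(3,1,2) by (rule holomorphic_derivI)
  have "((\<lambda>x. (g x)\<^sup>2) has_field_derivative 2 * g x * deriv g x) (at x)"
    by (rule derivative_eq_intros g refl)+ simp
  then have "(f has_field_derivative 2 * g x * deriv g x) (at x)"
    by (rule has_field_derivative_transform_within_open[OF _ assms(1,2,4)])
  then have "2 * g x * deriv g x = f'"
    using assms(5) by (rule DERIV_unique)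
  moreover have "g x \<noteq> 0" and fx: "f x = (g x)\<^sup>2"
    using assms(4)[OF assms(2)] assms(6) by auto
  ultimately have "deriv g x = g x * (f' / (2 * f x))"
    unfolding fx by (simp add: field_simps power2_eq_square)
  with g show ?thesis
    by simp
qed

lemma prod_log_derivative:
  fixes f u :: "'a \<Rightarrow> complex \<Rightarrow> complex"
  assumes "finite A" "\<And>k. k \<in> A \<Longrightarrow> (f k has_field_derivative f k x * u k x) (at x)"
  shows "((\<lambda>x. \<Prod>k\<in>A. f k x) has_field_derivative (\<Prod>k\<in>A. f k x) * (\<Sum>k\<in>A. u k x)) (at x)"
  using assms
proof (induction A rule: finite_induct)
  case (insert a A)
  have "((\<lambda>x. f a x * (\<Prod>k\<in>A. f k x)) has_field_derivative
      (f a x * u a x) * (\<Prod>k\<in>A. f k x) + ((\<Prod>k\<in>A. f k x) * (\<Sum>k\<in>A. u k x)) * f a x) (at x)"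
    using insert by (intro DERIV_mult) auto
  then show ?case
    using insert.hyps by (simp add: algebra_simps)
qed simp

lemma sum_off_diagonal_swap:
  fixes F :: "'a \<Rightarrow> 'a \<Rightarrow> 'b::comm_monoid_add"
  assumes "finite A"
  shows "(\<Sum>k\<in>A. \<Sum>j\<in>A - {k}. F j k) = (\<Sum>k\<in>A. \<Sum>j\<in>A - {k}. F k j)"
proof -
  have "A - {k} = {j \<in> A. k \<noteq> j}" "A - {k} = {j \<in> A. j \<noteq> k}" for k
    by auto
  then show ?thesis
    using sum.swap_restrict[OF assms assms, of "\<lambda>k j. F j k" "\<lambda>k j. k \<noteq> j"] by simp
qed

text \<open>
  Multiplied by \<open>\<Xi>\<^sup>2\<close>, the Riccati equation for \<open>u\<close> becomes the defining equation of \<open>Q\<close>: the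
  terms linear in \<open>q\<close> cancel, and \<open>q\<^sup>2 = - Q\<close>.
\<close>

lemma hermite_ansatz:
  fixes \<Xi> g I v :: "complex \<Rightarrow> complex"
  assumes U: "open U" and \<Xi>: "\<Xi> holomorphic_on U" "\<forall>x\<in>U. \<Xi> x \<noteq> 0"
    and g: "g holomorphic_on U" "\<forall>x\<in>U. (g x)\<^sup>2 = \<Xi> x"
    and q: "q\<^sup>2 = - Q"
    and I: "\<forall>x\<in>U. (I has_field_derivative q / \<Xi> x) (at x)"
    and Q: "\<forall>x\<in>U.
      Q = (\<Xi> x)\<^sup>2 * (E - v x) + 1 / 2 * \<Xi> x * deriv (deriv \<Xi>) x - 1 / 4 * (deriv \<Xi> x)\<^sup>2"
  defines "u \<equiv> \<lambda>x. deriv \<Xi> x / (2 * \<Xi> x) + q / \<Xi> x"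
  shows "x \<in> U \<Longrightarrow> ((\<lambda>x. g x * exp (I x)) has_field_derivative (g x * exp (I x)) * u x) (at x)"
    and "x \<in> U \<Longrightarrow> \<exists>u'. (u has_field_derivative u') (at x) \<and> (u x)\<^sup>2 + u' = v x - E"
proof -
  assume x: "x \<in> U"
  note d = holomorphic_derivI[OF \<Xi>(1) U x]
    holomorphic_derivI[OF holomorphic_deriv[OF \<Xi>(1) U] U x]
  have "(g has_field_derivative g x * (deriv \<Xi> x / (2 * \<Xi> x))) (at x)"
    using square_root_log_derivative[OF U x g(1) bspec[OF g(2)] d(1)] bspec[OF \<Xi>(2) x] by simp
  from DERIV_mult[OF this DERIV_fun_exp[OF bspec[OF I x]]]
  show "((\<lambda>x. g x * exp (I x)) has_field_derivative (g x * exp (I x)) * u x) (at x)"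
    by (simp add: u_def algebra_simps)
  define z z1 z2 where "z = \<Xi> x" and "z1 = deriv \<Xi> x" and "z2 = deriv (deriv \<Xi>) x"
  define u' where "u' = (z2 * (2 * z) - z1 * (2 * z1)) / (2 * z)\<^sup>2 - q * z1 / z\<^sup>2"
  have z: "z \<noteq> 0" using bspec[OF \<Xi>(2) x] by (simp add: z_def)
  have "(u has_field_derivative u') (at x)"
    unfolding u_def u'_def z_def z1_def z2_def using bspec[OF \<Xi>(2) x]
    by (auto intro!: derivative_eq_intros d simp: power2_eq_square)
  moreover have "(z1 / (2 * z) + q / z)\<^sup>2 + u' = v x - E"
  proof -
    have "((z1 / (2 * z) + q / z)\<^sup>2 + u') * (4 * z\<^sup>2) = (z1 + 2 * q)\<^sup>2 + 2 * z2 * z - 2 * z1\<^sup>2 - 4 * q * z1"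
      unfolding u'_def using z by (simp add: field_simps power2_eq_square)
    also have "\<dots> = 4 * q\<^sup>2 + 2 * z2 * z - z1\<^sup>2"
      by (simp add: algebra_simps power2_eq_square)
    also have "\<dots> = (v x - E) * (4 * z\<^sup>2)"
      unfolding q bspec[OF Q x] z_def z1_def z2_def by (simp add: field_simps power2_eq_square)
    finally show ?thesis
      using z by simp
  qed
  ultimately show "\<exists>u'. (u has_field_derivative u') (at x) \<and> (u x)\<^sup>2 + u' = v x - E"
    unfolding u_def z_def z1_def by blast
qed

section \<open>The potential and the gauge transformation to $H_g$\<close>

text \<open>
  The contribution of one pair \<open>\<plusminus>\<delta>\<close>, as an identity between Laurent polynomials in
  \<open>p = \<wp> x - b'\<close>.  Here \<open>t\<close>, \<open>t2\<close> and \<open>sum2\<close> stand for \<open>\<wp>'\<^sup>2\<close>, \<open>\<wp>''\<close> and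
  \<open>\<wp> (x - \<delta>) + \<wp> (x + \<delta>)\<close>; the coefficient \<open>\<rho> / 2 * (\<rho> / 2 + 1)\<close> of the last one is dictated by
  the double pole at \<open>p = 0\<close>.
\<close>

lemma partial_fractions_diagonal:
  fixes p b' y t t2 G2 G3 \<rho> sum2 :: complex
  assumes "p \<noteq> 0" "y = p + b'" "t = 4 * y ^ 3 - G2 * y - G3" "t2 = 6 * y\<^sup>2 - G2 / 2"
    and sum2: "sum2 * p\<^sup>2 = 2 * b' * p\<^sup>2 + (6 * b'\<^sup>2 - G2 / 2) * p + (4 * b' ^ 3 - G2 * b' - G3)"
  shows "1 / 4 * (\<rho> * \<rho> * (t / (p * p))) - 1 / 2 * (\<rho> * (t2 / p - t / p\<^sup>2))
    = \<rho> / 2 * (\<rho> / 2 + 1) * sum2 + \<rho>\<^sup>2 * (12 * b'\<^sup>2 - G2) / (8 * p) + (\<rho>\<^sup>2 - \<rho>) * y + 3 / 2 * \<rho>\<^sup>2 * b'"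
proof -
  define q where "q = 1 / p"
  have pq: "p * q = 1" using assms(1) by (simp add: q_def)
  define B where "B = 4 * b' ^ 3 - G2 * b' - G3"
  define C where "C = 12 * b'\<^sup>2 - G2"
  have "t = B + C * p + 12 * b' * p\<^sup>2 + 4 * p ^ 3"
    unfolding assms(3,2) B_def C_def by (simp add: algebra_simps power2_eq_square power3_eq_cube)
  then have t: "t * q\<^sup>2 = B * q\<^sup>2 + C * q + 12 * b' + 4 * p"
    using pq by algebra
  have "2 * t2 = C + 24 * b' * p + 12 * p\<^sup>2"
    unfolding assms(4,2) C_def by (simp add: algebra_simps power2_eq_square)
  then have t2: "2 * (t2 * q) = C * q + 24 * b' + 12 * p"
    using pq by algebra
  have "2 * (sum2 * p\<^sup>2) = 4 * b' * p\<^sup>2 + C * p + 2 * B"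
    unfolding sum2 B_def C_def by (simp add: algebra_simps)
  then have s2: "2 * sum2 = 4 * b' + C * q + 2 * B * q\<^sup>2"
    using pq by algebra
  have t2': "t2 * q = (C * q + 24 * b' + 12 * p) / 2" and s2': "sum2 = (4 * b' + C * q + 2 * B * q\<^sup>2) / 2"
    using t2 s2 by (simp_all add: eq_divide_eq mult.commute)
  have q: "t / (p * p) = t * q\<^sup>2" "t / p\<^sup>2 = t * q\<^sup>2" "t2 / p = t2 * q" "\<rho>\<^sup>2 * C / (8 * p) = \<rho>\<^sup>2 * C * q / 8"
    by (simp_all add: q_def power2_eq_square)
  show ?thesis
    unfolding C_def[symmetric] q t t2' s2' assms(2) by (simp add: field_simps power2_eq_square)
qed

text \<open>
  The right-hand side is arranged as \<open>G b1 b2 + G b2 b1\<close>, so that a sum over all ordered pairs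
  of distinct indices is twice the sum of one of the two parts.
\<close>

lemma partial_fractions_off_diagonal:
  fixes y b1 b2 t G2 G3 :: complex
  assumes "y \<noteq> b1" "y \<noteq> b2" "b1 \<noteq> b2" "t = 4 * y ^ 3 - G2 * y - G3"
  shows "t / ((y - b1) * (y - b2))
    = (2 * y + 4 * b1 + (4 * b1 ^ 3 - G2 * b1 - G3) / ((y - b1) * (b1 - b2)))
    + (2 * y + 4 * b2 + (4 * b2 ^ 3 - G2 * b2 - G3) / ((y - b2) * (b2 - b1)))"
proof -
  define u1 u2 w where "u1 = 1 / (y - b1)" and "u2 = 1 / (y - b2)" and "w = 1 / (b1 - b2)"
  have inv: "(y - b1) * u1 = 1" "(y - b2) * u2 = 1" "(b1 - b2) * w = 1"
    using assms(1-3) by (simp_all add: u1_def u2_def w_def)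
  have "t / ((y - b1) * (y - b2)) = t * u1 * u2"
    "(4 * b1 ^ 3 - G2 * b1 - G3) / ((y - b1) * (b1 - b2)) = (4 * b1 ^ 3 - G2 * b1 - G3) * u1 * w"
    by (simp_all add: u1_def u2_def w_def)
  moreover have "1 / (b2 - b1) = - w"
    unfolding w_def by (metis minus_diff_eq divide_minus_right)
  then have "(4 * b2 ^ 3 - G2 * b2 - G3) / ((y - b2) * (b2 - b1)) = - (4 * b2 ^ 3 - G2 * b2 - G3) * u2 * w"
    unfolding u2_def by (metis (no_types, lifting) divide_divide_eq_left mult.commute mult.right_neutral mult_minus_left mult_minus_right times_divide_eq_right)
  ultimately show ?thesis
    using inv assms(4) by simp algebra
qed

locale potential_data = period_pair +
  fixes l r :: "nat \<Rightarrow> nat" and M :: nat and b \<delta> s :: "nat \<Rightarrow> complex"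
  assumes \<delta>_notin: "k \<in> {1..M} \<Longrightarrow> \<delta> k \<notin> \<Lambda>"
    and wp_\<delta>: "k \<in> {1..M} \<Longrightarrow> \<wp> (\<delta> k) = b k"
    and b_not_e: "k \<in> {1..M} \<Longrightarrow> i \<in> {1..3} \<Longrightarrow> b k \<noteq> e i"
    and b_distinct: "inj_on b {1..M}"
begin

abbreviation S where "S \<equiv> singular_set \<omega>1 \<omega>3 l M \<delta>"
abbreviation v where "v \<equiv> potential \<omega>1 \<omega>3 l M r \<delta> s"
abbreviation a where "a \<equiv> H_g_coeff1 \<omega>1 \<omega>3 M r \<delta>"
abbreviation c where "c \<equiv> H_g_coeff0 \<omega>1 \<omega>3 l M r b \<delta> s"

lemma singular_set_sparse: "S sparse_in UNIV"
proof -
  have sp: "{x. x \<in> \<Lambda>} sparse_in UNIV" "{x. x - \<delta> k \<in> \<Lambda>} sparse_in UNIV" for k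
    using lattice_sparse lattice_translate_sparse[of "- \<delta> k"] by simp_all
  \<comment> \<open>a larger set, in which the condition \<open>l i > 0\<close> is dropped\<close>
  have "{x. x \<in> \<Lambda>} \<union> (\<Union>i\<in>{1..3}. {x. x + half_period \<omega>1 \<omega>3 i \<in> \<Lambda>})
      \<union> (\<Union>k\<in>{1..M}. {x. x - \<delta> k \<in> \<Lambda>} \<union> {x. x + \<delta> k \<in> \<Lambda>}) sparse_in UNIV"
    by (intro sparse_in_union' sparse_in_UN_finite lattice_translate_sparse sp) auto
  then show ?thesis
    by (rule sparse_in_subset2) (auto simp: singular_set_def)
qed

lemma open_regular_set: "open (- S)"
  by (intro open_Compl sparse_in_UNIV_imp_closed singular_set_sparse)

lemma connected_regular_set: "connected (- S)"
  using sparse_imp_connected[OF _ connected_UNIV open_UNIV singular_set_sparse]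
  by (simp add: Compl_eq_Diff_UNIV)

text \<open>
  In the last claim, \<open>b k\<close> is a value of \<open>\<wp>\<close> different from all \<open>e i\<close>, hence \<open>\<wp>' (\<delta> k) \<noteq> 0\<close> and
  \<open>\<plusminus>\<delta> k\<close> are the only points with this value, up to periods.
\<close>

lemma regular_pointD:
  assumes "x \<notin> S"
  shows "x \<notin> \<Lambda>"
    and "i \<in> {0..3} \<Longrightarrow> l i > 0 \<Longrightarrow> x + half_period \<omega>1 \<omega>3 i \<notin> \<Lambda>"
    and "k \<in> {1..M} \<Longrightarrow> x - \<delta> k \<notin> \<Lambda> \<and> x + \<delta> k \<notin> \<Lambda>"
    and "k \<in> {1..M} \<Longrightarrow> \<wp> x \<noteq> b k"
proof -
  show x: "x \<notin> \<Lambda>"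
    using assms by (auto simp: singular_set_def)
  show "x + half_period \<omega>1 \<omega>3 i \<notin> \<Lambda>" if "i \<in> {0..3}" "l i > 0"
  proof (cases "i = 0")
    case True
    then show ?thesis using x by (simp add: half_period_def)
  next
    case False
    then have "i \<in> {1..3}" using that by auto
    then show ?thesis using assms that(2) unfolding singular_set_def by blast
  qed
  show \<delta>: "x - \<delta> k \<notin> \<Lambda> \<and> x + \<delta> k \<notin> \<Lambda>" if "k \<in> {1..M}"
    using assms that unfolding singular_set_def by blast
  show "\<wp> x \<noteq> b k" if k: "k \<in> {1..M}"
  proof
    assume "\<wp> x = b k"
    then have "\<wp> x = \<wp> (\<delta> k)"
      using wp_\<delta>[OF k] by simp
    moreover have "(deriv \<wp> (\<delta> k))\<^sup>2 \<noteq> 0"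
      unfolding weierstrass_equations(3)[OF \<delta>_notin[OF k]] wp_\<delta>[OF k] using b_not_e[OF k] by auto
    then have "deriv \<wp> (\<delta> k) \<noteq> 0"
      by simp
    ultimately show False
      using wp_eq_imp_congruent[OF \<delta>_notin[OF k] x] \<delta>[OF k] by auto
  qed
qed

lemma wp_shift_holomorphic_regular:
  "i \<in> {0..3} \<Longrightarrow> l i > 0 \<Longrightarrow> (\<lambda>x. \<wp> (x + half_period \<omega>1 \<omega>3 i)) holomorphic_on - S"
  "k \<in> {1..M} \<Longrightarrow> (\<lambda>x. \<wp> (x - \<delta> k)) holomorphic_on - S"
  "k \<in> {1..M} \<Longrightarrow> (\<lambda>x. \<wp> (x + \<delta> k)) holomorphic_on - S"
  "\<wp> holomorphic_on - S"
proof -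
  show "(\<lambda>x. \<wp> (x + half_period \<omega>1 \<omega>3 i)) holomorphic_on - S" if "i \<in> {0..3}" "l i > 0"
    by (rule holomorphic_on_subset[OF wp_shift_holomorphic]) (use regular_pointD(2) that in auto)
  show "(\<lambda>x. \<wp> (x - \<delta> k)) holomorphic_on - S" if "k \<in> {1..M}"
    using holomorphic_on_subset[OF wp_shift_holomorphic[of "- \<delta> k"], of "- S"]
      regular_pointD(3)[OF _ that] by auto
  show "(\<lambda>x. \<wp> (x + \<delta> k)) holomorphic_on - S" if "k \<in> {1..M}"
    by (rule holomorphic_on_subset[OF wp_shift_holomorphic]) (use regular_pointD(3) that in auto)
  show "\<wp> holomorphic_on - S"
    by (rule holomorphic_on_subset[OF wp_holomorphic]) (use regular_pointD(1) in auto)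
qed

lemma wp_minus_b_nonzero: "x \<in> - S \<Longrightarrow> k \<in> {1..M} \<Longrightarrow> \<wp> x - \<wp> (\<delta> k) \<noteq> 0"
  using regular_pointD(4) wp_\<delta> by simp

text \<open>
  A half period with \<open>l i = 0\<close> may lie outside the singular set; the corresponding term is
  then identically zero.
\<close>

lemma potential_holomorphic: "v holomorphic_on - S"
proof -
  have "(\<lambda>x. of_nat (l i * (l i + 1)) * \<wp> (x + half_period \<omega>1 \<omega>3 i)) holomorphic_on - S"
    if "i \<in> {0..3}" for i
  proof (cases "l i = 0")
    case False
    then show ?thesis
      by (intro holomorphic_intros wp_shift_holomorphic_regular that) simp
  qed simp
  then have "(\<lambda>x. \<Sum>i=0..3. of_nat (l i * (l i + 1)) * \<wp> (x + half_period \<omega>1 \<omega>3 i)) holomorphic_on - S"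
    by (rule holomorphic_on_sum)
  moreover have "(\<lambda>x. \<Sum>k=1..M. of_nat (r k) / 2 * (of_nat (r k) / 2 + 1) * (\<wp> (x - \<delta> k) + \<wp> (x + \<delta> k))
      + s k / (\<wp> x - \<wp> (\<delta> k))) holomorphic_on - S"
    by (intro holomorphic_intros wp_shift_holomorphic_regular wp_minus_b_nonzero) auto
  ultimately show ?thesis
    unfolding potential_def[abs_def] by (rule holomorphic_on_add)
qed

lemma rational_form_holomorphic:
  "(\<lambda>x. c0 + (\<Sum>i=0..3. \<Sum>j<l i. \<beta> i j * \<wp> (x + half_period \<omega>1 \<omega>3 i) ^ (l i - j))
      + (\<Sum>k=1..M. \<Sum>j<r k. d k j / (\<wp> x - \<wp> (\<delta> k)) ^ (r k - j))) holomorphic_on - S"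
proof -
  have "0 < l i" if "j \<in> {..<l i}" for i j
    using that by auto
  then show ?thesis
    by (intro holomorphic_intros wp_shift_holomorphic_regular power_not_zero wp_minus_b_nonzero)
qed

definition coeff1_deriv :: "complex \<Rightarrow> complex" where
  "coeff1_deriv x = (\<Sum>k=1..M. of_nat (r k) * (deriv (deriv \<wp>) x / (\<wp> x - b k)
             - (deriv \<wp> x)\<^sup>2 / (\<wp> x - b k)\<^sup>2))"

lemma H_g_coeff1_eq: "a x = (\<Sum>k=1..M. of_nat (r k) * deriv \<wp> x / (\<wp> x - b k))"
  unfolding H_g_coeff1_def using wp_\<delta> by (intro sum.cong) auto

lemma H_g_coeff1_derivative:
  assumes "x \<notin> S"
  shows "(a has_field_derivative coeff1_deriv x) (at x)"
  unfolding H_g_coeff1_eq[abs_def] coeff1_deriv_def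
proof (rule DERIV_sum)
  fix k assume k: "k \<in> {1..M}"
  note d = wp_DERIV[OF regular_pointD(1)[OF assms]] wp_DERIV2[OF regular_pointD(1)[OF assms]]
  have "\<wp> x - b k \<noteq> 0"
    using regular_pointD(4)[OF assms k] by simp
  then have "((\<lambda>x. of_nat (r k) * deriv \<wp> x / (\<wp> x - b k)) has_field_derivative
      (of_nat (r k) * deriv (deriv \<wp>) x * (\<wp> x - b k) - of_nat (r k) * deriv \<wp> x * deriv \<wp> x)
        / ((\<wp> x - b k) * (\<wp> x - b k))) (at x)"
    by (auto intro!: derivative_eq_intros d)
  moreover have "(\<rho> * t2 * u - \<rho> * t * t) / (u * u) = \<rho> * (t2 / u - t\<^sup>2 / u\<^sup>2)"
    if "u \<noteq> 0" for \<rho> t t2 u :: complex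
    using that by (simp add: field_simps power2_eq_square)
  ultimately show "((\<lambda>x. of_nat (r k) * deriv \<wp> x / (\<wp> x - b k)) has_field_derivative
      of_nat (r k) * (deriv (deriv \<wp>) x / (\<wp> x - b k) - (deriv \<wp> x)\<^sup>2 / (\<wp> x - b k)\<^sup>2)) (at x)"
    using \<open>\<wp> x - b k \<noteq> 0\<close> by simp
qed

text \<open>
  In \<open>a\<^sup>2 / 4 - a' / 2\<close> the diagonal terms produce the double poles of \<open>v\<close> and the off-diagonal ones only simple
  poles; the simple poles are cancelled by the correction in \<open>s_tilde\<close>, the multiples of \<open>\<wp>\<close> by the
  changed coefficient of \<open>\<wp>\<close> in \<open>c\<close>, and what is left is \<open>C_g\<close>.
\<close>

lemma H_g_coefficients_identity:
  assumes "x \<notin> S"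
  shows "1 / 4 * (a x)\<^sup>2 - 1 / 2 * coeff1_deriv x + c x = v x + C_g M r b"
proof -
  define y where "y = \<wp> x"
  define t where "t = (deriv \<wp> x)\<^sup>2"
  define t2 where "t2 = deriv (deriv \<wp>) x"
  define \<rho> where "\<rho> = (\<lambda>k. of_nat (r k) :: complex)"
  define R where "R = (\<Sum>k=1..M. \<rho> k)"
  define P where "P = (\<lambda>z. 4 * z ^ 3 - g2 * z - g3)"
  define T where "T = (\<lambda>k. \<wp> (x - \<delta> k) + \<wp> (x + \<delta> k))"
  define \<Sigma> where "\<Sigma> = (\<lambda>k. \<Sum>j\<in>{1..M} - {k}. \<rho> j / (b k - b j))"
  \<comment> \<open>half of the off-diagonal term for the pair \<open>(k, j)\<close>; the other half is \<open>F j k\<close>\<close>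
  define F where "F = (\<lambda>k j. \<rho> k * \<rho> j * (2 * y + 4 * b k + P (b k) / ((y - b k) * (b k - b j))))"
  have x: "x \<notin> \<Lambda>"
    using assms by (rule regular_pointD)
  have t: "t = 4 * y ^ 3 - g2 * y - g3" and t2: "t2 = 6 * y\<^sup>2 - g2 / 2"
    unfolding t_def t2_def y_def using weierstrass_equations(1,2)[OF x] by simp_all
  have y_neq: "y \<noteq> b k" if "k \<in> {1..M}" for k
    unfolding y_def using regular_pointD(4)[OF assms that] .
  have diagonal: "1 / 4 * (\<rho> k * \<rho> k * (t / ((y - b k) * (y - b k)))) - 1 / 2 * (\<rho> k * (t2 / (y - b k) - t / (y - b k)\<^sup>2))
    = \<rho> k / 2 * (\<rho> k / 2 + 1) * T k + (\<rho> k)\<^sup>2 * (12 * (b k)\<^sup>2 - g2) / (8 * (y - b k))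
      + ((\<rho> k)\<^sup>2 - \<rho> k) * y + 3 / 2 * (\<rho> k)\<^sup>2 * b k" if k: "k \<in> {1..M}" for k
  proof (rule partial_fractions_diagonal)
    show "T k * (y - b k)\<^sup>2 = 2 * b k * (y - b k)\<^sup>2 + (6 * (b k)\<^sup>2 - g2 / 2) * (y - b k)
        + (4 * b k ^ 3 - g2 * b k - g3)"
      using wp_addition_formula[OF \<delta>_notin[OF k] x] regular_pointD(3)[OF assms k]
        weierstrass_equations(1,2)[OF \<delta>_notin[OF k]] wp_\<delta>[OF k]
      by (simp add: T_def y_def add.commute)
  qed (use y_neq[OF k] t t2 in auto)
  have off_diagonal: "\<rho> k * \<rho> j * (t / ((y - b k) * (y - b j))) = F k j + F j k"
    if "k \<in> {1..M}" "j \<in> {1..M} - {k}" for k j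
  proof -
    have "b k \<noteq> b j"
      using inj_onD[OF b_distinct, of k j] that by blast
    then have "t / ((y - b k) * (y - b j))
        = (2 * y + 4 * b k + P (b k) / ((y - b k) * (b k - b j)))
        + (2 * y + 4 * b j + P (b j) / ((y - b j) * (b j - b k)))"
      unfolding P_def using that by (intro partial_fractions_off_diagonal y_neq t) auto
    then show ?thesis
      unfolding F_def by (simp only: mult.commute[of "\<rho> j" "\<rho> k"] distrib_left[symmetric])
  qed
  have F_sum: "(\<Sum>j\<in>{1..M} - {k}. F k j)
      = \<rho> k * (2 * y + 4 * b k) * (R - \<rho> k) + \<rho> k * P (b k) * \<Sigma> k / (y - b k)"
    if k: "k \<in> {1..M}" for k
  proof -
    have "(\<Sum>j\<in>{1..M} - {k}. F k j)
        = (\<Sum>j\<in>{1..M} - {k}. \<rho> k * (2 * y + 4 * b k) * \<rho> j + \<rho> k * P (b k) / (y - b k) * (\<rho> j / (b k - b j)))"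
      by (intro sum.cong) (simp_all add: F_def distrib_left mult_ac)
    also have "\<dots> = \<rho> k * (2 * y + 4 * b k) * (\<Sum>j\<in>{1..M} - {k}. \<rho> j) + \<rho> k * P (b k) / (y - b k) * \<Sigma> k"
      by (simp add: sum.distrib sum_distrib_left \<Sigma>_def)
    also have "(\<Sum>j\<in>{1..M} - {k}. \<rho> j) = R - \<rho> k"
      unfolding R_def using k by (simp add: sum_diff1)
    finally show ?thesis
      by simp
  qed
  have "(a x)\<^sup>2 = (\<Sum>k=1..M. \<Sum>j=1..M. \<rho> k * \<rho> j * (t / ((y - b k) * (y - b j))))"
    unfolding H_g_coeff1_eq power2_eq_square sum_product
    by (intro sum.cong) (auto simp: \<rho>_def t_def y_def power2_eq_square)
  also have "\<dots> = (\<Sum>k=1..M. \<rho> k * \<rho> k * (t / ((y - b k) * (y - b k)))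
      + (\<Sum>j\<in>{1..M} - {k}. \<rho> k * \<rho> j * (t / ((y - b k) * (y - b j)))))"
    by (intro sum.cong refl sum.remove) auto
  also have "\<dots> = (\<Sum>k=1..M. \<rho> k * \<rho> k * (t / ((y - b k) * (y - b k))))
      + (\<Sum>k=1..M. \<Sum>j\<in>{1..M} - {k}. F k j + F j k)"
    unfolding sum.distrib[symmetric] by (intro sum.cong refl arg_cong2[where f = "(+)"] off_diagonal) auto
  also have "(\<Sum>k=1..M. \<Sum>j\<in>{1..M} - {k}. F k j + F j k) = 2 * (\<Sum>k=1..M. \<Sum>j\<in>{1..M} - {k}. F k j)"
    by (simp only: sum.distrib sum_off_diagonal_swap[OF finite_atLeastAtMost, of F] mult_2)
  also have "(\<Sum>k=1..M. \<Sum>j\<in>{1..M} - {k}. F k j)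
      = (\<Sum>k=1..M. \<rho> k * (2 * y + 4 * b k) * (R - \<rho> k) + \<rho> k * P (b k) * \<Sigma> k / (y - b k))"
    by (intro sum.cong F_sum) auto
  finally have a_sq: "(a x)\<^sup>2 = (\<Sum>k=1..M. \<rho> k * \<rho> k * (t / ((y - b k) * (y - b k))))
      + 2 * (\<Sum>k=1..M. \<rho> k * (2 * y + 4 * b k) * (R - \<rho> k) + \<rho> k * P (b k) * \<Sigma> k / (y - b k))" .
  have coeff1_deriv_eq: "coeff1_deriv x = (\<Sum>k=1..M. \<rho> k * (t2 / (y - b k) - t / (y - b k)\<^sup>2))"
    unfolding coeff1_deriv_def \<rho>_def t2_def t_def y_def ..
  define W where "W = (\<Sum>i=1..3. of_nat (l i * (l i + 1)) * \<wp> (x + half_period \<omega>1 \<omega>3 i))"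
  have c_eq: "c x = (of_nat (l 0) + R) * (of_nat (l 0) + 1 - R) * y + W
      + (\<Sum>k=1..M. s_tilde \<omega>1 \<omega>3 M r b s k / (y - b k))"
    unfolding H_g_coeff0_def W_def R_def \<rho>_def y_def using wp_\<delta> by simp
  have v_eq: "v x = of_nat (l 0) * (of_nat (l 0) + 1) * y + W
      + (\<Sum>k=1..M. \<rho> k / 2 * (\<rho> k / 2 + 1) * T k + s k / (y - b k))"
    unfolding potential_def W_def \<rho>_def y_def T_def using wp_\<delta>
    by (simp add: sum.atLeast_Suc_atMost[of 0 3] half_period_def distrib_left)
  have s_tilde: "s_tilde \<omega>1 \<omega>3 M r b s k = s k - (\<rho> k)\<^sup>2 * (12 * (b k)\<^sup>2 - g2) / 8 - \<rho> k * P (b k) * \<Sigma> k / 2" for k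
  proof -
    have "s_tilde \<omega>1 \<omega>3 M r b s k
        = s k - \<rho> k * (1 / 8 * \<rho> k * (12 * (b k)\<^sup>2 - g2) + 1 / 2 * P (b k) * \<Sigma> k)"
      by (simp only: s_tilde_def \<rho>_def P_def \<Sigma>_def)
    also have "\<dots> = s k - (\<rho> k)\<^sup>2 * (12 * (b k)\<^sup>2 - g2) / 8 - \<rho> k * P (b k) * \<Sigma> k / 2"
      by (simp add: field_simps power2_eq_square)
    finally show ?thesis .
  qed
  have termwise: "1 / 4 * (sum A X + 2 * sum B X) - 1 / 2 * sum A' X + sum D X
      = (\<Sum>k\<in>X. (1 / 4 * A k - 1 / 2 * A' k) + 1 / 2 * B k + D k)"
    for A A' B D :: "nat \<Rightarrow> complex" and X
    by (simp only: sum.distrib sum_subtractf sum_distrib_left[symmetric]) (simp add: algebra_simps)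
  have "1 / 4 * (a x)\<^sup>2 - 1 / 2 * coeff1_deriv x + (\<Sum>k=1..M. s_tilde \<omega>1 \<omega>3 M r b s k / (y - b k))
    = (\<Sum>k=1..M. (1 / 4 * (\<rho> k * \<rho> k * (t / ((y - b k) * (y - b k)))) - 1 / 2 * (\<rho> k * (t2 / (y - b k) - t / (y - b k)\<^sup>2)))
        + 1 / 2 * (\<rho> k * (2 * y + 4 * b k) * (R - \<rho> k) + \<rho> k * P (b k) * \<Sigma> k / (y - b k))
        + s_tilde \<omega>1 \<omega>3 M r b s k / (y - b k))"
    unfolding a_sq coeff1_deriv_eq by (rule termwise)
  also have "\<dots> = (\<Sum>k=1..M. (\<rho> k / 2 * (\<rho> k / 2 + 1) * T k + s k / (y - b k))
      + (\<rho> k * (R * y - y) + 2 * R * (b k * \<rho> k) - 1 / 2 * (b k * (\<rho> k)\<^sup>2)))"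
  proof (intro sum.cong refl)
    fix k assume "k \<in> {1..M}"
    show "(1 / 4 * (\<rho> k * \<rho> k * (t / ((y - b k) * (y - b k)))) - 1 / 2 * (\<rho> k * (t2 / (y - b k) - t / (y - b k)\<^sup>2)))
        + 1 / 2 * (\<rho> k * (2 * y + 4 * b k) * (R - \<rho> k) + \<rho> k * P (b k) * \<Sigma> k / (y - b k))
        + s_tilde \<omega>1 \<omega>3 M r b s k / (y - b k)
      = (\<rho> k / 2 * (\<rho> k / 2 + 1) * T k + s k / (y - b k))
      + (\<rho> k * (R * y - y) + 2 * R * (b k * \<rho> k) - 1 / 2 * (b k * (\<rho> k)\<^sup>2))"
      unfolding diagonal[OF \<open>k \<in> {1..M}\<close>] s_tilde
      by (simp add: diff_divide_distrib add_divide_distrib)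
        (simp add: algebra_simps power2_eq_square add_divide_distrib diff_divide_distrib)
  qed
  also have "\<dots> = (\<Sum>k=1..M. \<rho> k / 2 * (\<rho> k / 2 + 1) * T k + s k / (y - b k))
      + (R * (R * y - y) + (2 * R * (\<Sum>k=1..M. b k * \<rho> k) - 1 / 2 * (\<Sum>k=1..M. b k * (\<rho> k)\<^sup>2)))"
    by (simp add: sum.distrib sum_subtractf sum_distrib_left sum_distrib_right R_def)
  also have "2 * R * (\<Sum>k=1..M. b k * \<rho> k) - 1 / 2 * (\<Sum>k=1..M. b k * (\<rho> k)\<^sup>2) = C_g M r b"
    by (simp add: C_g_def R_def \<rho>_def)
  finally show ?thesis
    unfolding c_eq v_eq by (simp add: algebra_simps)
qed


lemma wp_factor_log_derivative:
  assumes "open U" "U \<inter> S = {}" "x \<in> U" "k \<in> {1..M}"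
    and \<sigma>: "\<sigma> holomorphic_on U" "\<And>x. x \<in> U \<Longrightarrow> (\<sigma> x)\<^sup>2 = \<wp> x - \<wp> (\<delta> k)"
  shows "((\<lambda>x. \<sigma> x ^ r k) has_field_derivative
    \<sigma> x ^ r k * (of_nat (r k) * deriv \<wp> x / (\<wp> x - b k) / 2)) (at x)"
proof -
  have x: "x \<notin> S"
    using assms(2,3) by blast
  have "((\<lambda>x. \<wp> x - \<wp> (\<delta> k)) has_field_derivative deriv \<wp> x) (at x)"
    using DERIV_diff[OF wp_DERIV[OF regular_pointD(1)[OF x]] DERIV_const] by simp
  then have "(\<sigma> has_field_derivative \<sigma> x * (deriv \<wp> x / (2 * (\<wp> x - \<wp> (\<delta> k))))) (at x)"
    using wp_minus_b_nonzero[of x k] x assms(4)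
    by (intro square_root_log_derivative[OF assms(1,3) \<sigma>]) auto
  from DERIV_power[OF this, of "r k"]
  have "((\<lambda>x. \<sigma> x ^ r k) has_field_derivative
      of_nat (r k) * (\<sigma> x * (deriv \<wp> x / (2 * (\<wp> x - b k))) * \<sigma> x ^ (r k - Suc 0))) (at x)"
    using wp_\<delta>[OF assms(4)] by simp
  also have "of_nat (r k) * (\<sigma> x * (deriv \<wp> x / (2 * (\<wp> x - b k))) * \<sigma> x ^ (r k - Suc 0))
      = \<sigma> x ^ r k * (of_nat (r k) * deriv \<wp> x / (\<wp> x - b k) / 2)"
    by (cases "r k") (simp_all add: mult_ac)
  finally show ?thesis .
qed

text \<open>
  Logarithmic derivatives add up, so \<open>\<psi> f\<close> has logarithmic derivative \<open>a / 2 + u\<close>, and the terms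
  \<open>a u\<close> coming from its square and from the first-order part of \<open>H_g\<close> cancel.
\<close>

lemma H_g_gauge_transform:
  assumes "open U" "U \<inter> S = {}" "x \<in> U"
    and f: "\<And>x. x \<in> U \<Longrightarrow> (f has_field_derivative f x * u x) (at x)"
    and u: "(u has_field_derivative u') (at x)" "(u x)\<^sup>2 + u' = v x - E"
    and \<psi>: "\<And>x. x \<in> U \<Longrightarrow> (\<psi> has_field_derivative \<psi> x * (a x / 2)) (at x)"
  shows "H_g \<omega>1 \<omega>3 l M r b \<delta> s (\<lambda>x. \<psi> x * f x) x - (E + C_g M r b) * (\<psi> x * f x) = 0"
proof -
  have x: "x \<notin> S"
    using assms(2,3) by blast
  have prod: "((\<lambda>x. \<psi> x * f x) has_field_derivative (\<psi> y * f y) * (a y / 2 + u y)) (at y)" if "y \<in> U" for y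
    using DERIV_mult[OF \<psi>[OF that] f[OF that]] by (simp add: algebra_simps)
  have "((\<lambda>y. a y / 2 + u y) has_field_derivative coeff1_deriv x / 2 + u') (at x)"
    by (intro DERIV_add DERIV_cdivide H_g_coeff1_derivative[OF x] u)
  from log_derivative_second_deriv[of U x "\<lambda>x. \<psi> x * f x" "\<lambda>y. a y / 2 + u y",
      OF assms(1,3) prod this]
  have d: "deriv (\<lambda>x. \<psi> x * f x) x = \<psi> x * f x * (a x / 2 + u x)"
    "deriv (deriv (\<lambda>x. \<psi> x * f x)) x = \<psi> x * f x * ((a x / 2 + u x)\<^sup>2 + (coeff1_deriv x / 2 + u'))"
    by simp_all
  have "H_g \<omega>1 \<omega>3 l M r b \<delta> s (\<lambda>x. \<psi> x * f x) x - (E + C_g M r b) * (\<psi> x * f x)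
      = (\<psi> x * f x) * ((1 / 4 * (a x)\<^sup>2 - 1 / 2 * coeff1_deriv x + c x) - ((u x)\<^sup>2 + u') - (E + C_g M r b))"
    unfolding H_g_def d by (simp add: field_simps power2_eq_square)
  also have "\<dots> = 0"
    unfolding H_g_coefficients_identity[OF x] u(2) by simp
  finally show ?thesis .
qed

end

theorem proposition3p3:
  fixes \<omega>1 \<omega>3 E c0 :: complex
    and M :: nat
    and l r :: "nat \<Rightarrow> nat"
    and b \<delta> s :: "nat \<Rightarrow> complex"
    and \<beta> d :: "nat \<Rightarrow> nat \<Rightarrow> complex"
    and \<Xi> :: "complex \<Rightarrow> complex"
  defines "S \<equiv> singular_set \<omega>1 \<omega>3 l M \<delta>"
    and "v \<equiv> potential \<omega>1 \<omega>3 l M r \<delta> s"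
  assumes periods_indep:
      "\<forall>t1 t3 :: real. of_real t1 * \<omega>1 + of_real t3 * \<omega>3 = 0 \<longrightarrow> t1 = 0 \<and> t3 = 0"
    and r_pos: "\<forall>k\<in>{1..M}. r k > 0"
    and \<delta>_wp: "\<forall>k\<in>{1..M}. \<delta> k \<notin> period_lattice \<omega>1 \<omega>3 \<and> wp \<omega>1 \<omega>3 (\<delta> k) = b k"
    and b_not_e: "\<forall>k\<in>{1..M}. \<forall>i\<in>{1..3}. b k \<noteq> wp_e \<omega>1 \<omega>3 i"
    and b_distinct: "inj_on b {1..M}"
    and apparent: "H_g_apparent \<omega>1 \<omega>3 l M r b \<delta> s E"
    and \<Xi>_nonzero: "\<exists>x. x \<notin> S \<and> \<Xi> x \<noteq> 0"
    and \<Xi>_even: "\<forall>x. x \<notin> S \<longrightarrow> \<Xi> (- x) = \<Xi> x"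
    and \<Xi>_periodic: "\<forall>x. x \<notin> S \<longrightarrow> \<Xi> (x + 2 * \<omega>1) = \<Xi> x \<and> \<Xi> (x + 2 * \<omega>3) = \<Xi> x"
    and \<Xi>_form: "\<forall>x. x \<notin> S \<longrightarrow>
        \<Xi> x = c0
          + (\<Sum>i=0..3. \<Sum>j<l i. \<beta> i j * wp \<omega>1 \<omega>3 (x + half_period \<omega>1 \<omega>3 i) ^ (l i - j))
          + (\<Sum>k=1..M. \<Sum>j<r k. d k j / (wp \<omega>1 \<omega>3 x - wp \<omega>1 \<omega>3 (\<delta> k)) ^ (r k - j))"
    and \<Xi>_ode: "\<forall>x. x \<notin> S \<longrightarrow>
        (deriv ^^ 3) \<Xi> x - 4 * (v x - E) * deriv \<Xi> x - 2 * deriv v x * \<Xi> x = 0"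
  shows "\<exists>Q.
    (\<forall>x. x \<notin> S \<longrightarrow>
       Q = (\<Xi> x)\<^sup>2 * (E - v x) + 1 / 2 * \<Xi> x * deriv (deriv \<Xi>) x - 1 / 4 * (deriv \<Xi> x)\<^sup>2)
    \<and> (\<forall>U sqrt\<Xi> sqrtQ I.
         \<comment> \<open>branches on \<open>U\<close> of the square roots and of the integral\<close>
         open U \<and> U \<inter> S = {} \<and> (\<forall>x\<in>U. \<Xi> x \<noteq> 0)
         \<and> sqrt\<Xi> holomorphic_on U \<and> (\<forall>x\<in>U. (sqrt\<Xi> x)\<^sup>2 = \<Xi> x)
         \<and> sqrtQ\<^sup>2 = - Q
         \<and> (\<forall>x\<in>U. (I has_field_derivative sqrtQ / \<Xi> x) (at x))
         \<longrightarrow>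
         (let \<Lambda> = (\<lambda>x. sqrt\<Xi> x * exp (I x)) in
            \<Lambda> holomorphic_on U
            \<and> (\<forall>x\<in>U. - deriv (deriv \<Lambda>) x + v x * \<Lambda> x = E * \<Lambda> x))
         \<and> (\<forall>\<sigma>.
              (\<forall>k\<in>{1..M}. \<sigma> k holomorphic_on U
                 \<and> (\<forall>x\<in>U. (\<sigma> k x)\<^sup>2 = wp \<omega>1 \<omega>3 x - wp \<omega>1 \<omega>3 (\<delta> k)))
              \<longrightarrow>
              (let \<Psi>\<^sub>g = (\<lambda>x. \<Prod>k=1..M. \<sigma> k x ^ r k);
                   \<Lambda>\<^sub>g = (\<lambda>x. \<Psi>\<^sub>g x * sqrt\<Xi> x * exp (I x)) in
                 \<Lambda>\<^sub>g holomorphic_on U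
                 \<and> (\<forall>x\<in>U. H_g \<omega>1 \<omega>3 l M r b \<delta> s \<Lambda>\<^sub>g x - (E + C_g M r b) * \<Lambda>\<^sub>g x = 0))))"
proof -
  interpret D: potential_data \<omega>1 \<omega>3 l r M b \<delta> s
    by unfold_locales (use periods_indep \<delta>_wp b_not_e b_distinct in auto)
  have "\<Xi> holomorphic_on - S"
    unfolding S_def
    by (rule holomorphic_transform[OF D.rational_form_holomorphic[of c0 \<beta> d]])
      (use \<Xi>_form S_def in auto)
  have "(\<lambda>x. (\<Xi> x)\<^sup>2 * (E - v x) + 1 / 2 * \<Xi> x * deriv (deriv \<Xi>) x - 1 / 4 * (deriv \<Xi> x)\<^sup>2)
      constant_on - S"
  proof (rule first_integral_constant)
    show "open (- S)" "connected (- S)" "v holomorphic_on - S"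
      unfolding S_def v_def
      by (rule D.open_regular_set D.connected_regular_set D.potential_holomorphic)+
  qed (use \<Xi>_ode \<open>\<Xi> holomorphic_on - S\<close> in \<open>simp_all add: numeral_3_eq_3\<close>)
  then obtain Q where Q: "\<And>x. x \<notin> S \<Longrightarrow>
      Q = (\<Xi> x)\<^sup>2 * (E - v x) + 1 / 2 * \<Xi> x * deriv (deriv \<Xi>) x - 1 / 4 * (deriv \<Xi> x)\<^sup>2"
    unfolding constant_on_def by (metis ComplI)
  show ?thesis
  proof (rule exI[of _ Q], rule conjI, goal_cases)
    case 1
    show ?case using Q by blast
  next
    case 2
    show ?case
    proof (intro allI impI, goal_cases)
      case (1 U g q I)
      then have U: "open U" "U \<inter> S = {}" and nz: "\<forall>x\<in>U. \<Xi> x \<noteq> 0"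
        and g: "g holomorphic_on U" "\<forall>x\<in>U. (g x)\<^sup>2 = \<Xi> x" and q: "q\<^sup>2 = - Q"
        and I: "\<forall>x\<in>U. (I has_field_derivative q / \<Xi> x) (at x)"
        by blast+
      have US: "U \<subseteq> - S" and QU: "\<forall>x\<in>U.
          Q = (\<Xi> x)\<^sup>2 * (E - v x) + 1 / 2 * \<Xi> x * deriv (deriv \<Xi>) x - 1 / 4 * (deriv \<Xi> x)\<^sup>2"
        using U(2) Q by blast+
      define f where "f = (\<lambda>x. g x * exp (I x))"
      define u where "u = (\<lambda>x. deriv \<Xi> x / (2 * \<Xi> x) + q / \<Xi> x)"
      note ansatz = hermite_ansatz[OF U(1) holomorphic_on_subset[OF \<open>\<Xi> holomorphic_on - S\<close> US] nz g q I QU]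
      have f: "(f has_field_derivative f x * u x) (at x)" if "x \<in> U" for x
        unfolding f_def u_def by (rule ansatz(1)[OF that])
      show ?case
      proof (rule conjI, goal_cases)
        case 1
        have "f holomorphic_on U"
          unfolding holomorphic_on_open[OF U(1)] using f by blast
        moreover have "- deriv (deriv f) x + v x * f x = E * f x" if x: "x \<in> U" for x
        proof -
          obtain u' where u': "(u has_field_derivative u') (at x)" "(u x)\<^sup>2 + u' = v x - E"
            using ansatz(2)[OF x] unfolding u_def by blast
          have "deriv (deriv f) x = f x * (v x - E)"
            unfolding u'(2)[symmetric] using U(1) x f u'(1) by (rule log_derivative_second_deriv(2))
          then show ?thesis
            by (simp add: algebra_simps)
        qed
        ultimately show ?case
          unfolding Let_def f_def by blast
      next
        case 2
        show ?case
        proof (intro allI impI, goal_cases)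
          case (1 \<sigma>)
          define \<psi> where "\<psi> = (\<lambda>x. \<Prod>k=1..M. \<sigma> k x ^ r k)"
          have \<psi>: "(\<psi> has_field_derivative \<psi> x * (H_g_coeff1 \<omega>1 \<omega>3 M r \<delta> x / 2)) (at x)"
            if x: "x \<in> U" for x
            unfolding \<psi>_def D.H_g_coeff1_eq sum_divide_distrib
          proof (rule prod_log_derivative[OF finite_atLeastAtMost])
            fix k assume k: "k \<in> {1..M}"
            show "((\<lambda>x. \<sigma> k x ^ r k) has_field_derivative
                \<sigma> k x ^ r k * (of_nat (r k) * deriv (wp \<omega>1 \<omega>3) x / (wp \<omega>1 \<omega>3 x - b k) / 2)) (at x)"
              by (rule D.wp_factor_log_derivative[OF U(1) U(2)[unfolded S_def] x k]) (use 1 k in blast)+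
          qed
          have prod_holomorphic: "(\<lambda>x. \<psi> x * f x) holomorphic_on U"
            unfolding holomorphic_on_open[OF U(1)] using DERIV_mult[OF \<psi> f] by blast
          have gauge: "H_g \<omega>1 \<omega>3 l M r b \<delta> s (\<lambda>x. \<psi> x * f x) x - (E + C_g M r b) * (\<psi> x * f x) = 0"
            if x: "x \<in> U" for x
          proof -
            obtain u' where u': "(u has_field_derivative u') (at x)" "(u x)\<^sup>2 + u' = v x - E"
              using ansatz(2)[OF x] unfolding u_def by blast
            show ?thesis
              by (rule D.H_g_gauge_transform[OF U(1) U(2)[unfolded S_def] x f u'(1) _ \<psi>])
                (use u'(2) v_def in auto)
          qed
          have "(\<lambda>x. (\<Prod>k=1..M. \<sigma> k x ^ r k) * g x * exp (I x)) = (\<lambda>x. \<psi> x * f x)"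
            by (simp add: \<psi>_def f_def mult.assoc)
          then show ?case
            unfolding Let_def using prod_holomorphic gauge by (simp add: fun_eq_iff)
        qed
      qed
    qed
  qed
qed

end
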